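(* Let $M$ be a smooth manifold of dimension $n\ge 2$ and let $F$ be a Berwald Finsler metric on $M$ (not assumed strictly convex or reversible). Then there exists a Riemannian metric $g$ on $M$ which is affine equivalent to $F$, i.e. every geodesic of $g$, considered as a parametrized curve, is also an $F$-geodesic.
   Context: A Finsler metric on $M$ is a function $F:TM\to\mathbb{R}_{\ge 0}$ that is smooth on the complement of the zero section of $TM$ and such that for every $x\in M$, all $\xi,\eta\in T_xM$ and all real $\lambda\ge 0$: $F(\lambda\xi)=\lambda F(\xi)$; $F(\xi+\eta)\le F(\xi)+F(\eta)$; and $F(\xi)=0$ implies $\xi=0$. Neither strict convexity of $F$ nor $F(-\xi)=F(\xi)$ is required. A Finsler metric $F$ is Berwald if there exists a symmetric (torsion-free) affine connection $\Gamma$ on $M$ whose parallel transport along curves preserves the function $F$; $\Gamma$ is then called the associated connection. A parametrized $F$-geodesic is a smooth curve with nonvanishing velocity satisfying the Euler–Lagrange equations of the Lagrangian $\frac12F^2$. (Since strict convexity is not assumed, an $F$-geodesic need not be determined by its initial velocity vector.) Geodesics of a Riemannian metric are the nonconstant affinely parametrized geodesics of its Levi-Civita connection. A metric $F_1$ is affine equivalent to a metric $F_2$ if every $F_1$-geodesic, considered as a parametrized curve, is also an $F_2$-geodesic. This relation is not a priori symmetric. *)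

theory Defs
  imports "HOL-Analysis.Analysis"
begin

section \<open>Smooth maps between open subsets of normed spaces\<close>

text \<open>
  In finite dimensions, where all uses below take place, and on open \<open>S\<close> the predicate
  \<open>Ck_on k S f\<close> says that \<open>f\<close> is k times continuously differentiable on \<open>S\<close>.
\<close>

primrec Ck_on :: "nat \<Rightarrow> 'a::real_normed_vector set \<Rightarrow> ('a \<Rightarrow> 'b::real_normed_vector) \<Rightarrow> bool" where
  "Ck_on 0 S f \<longleftrightarrow> continuous_on S f"
| "Ck_on (Suc k) S f \<longleftrightarrow>
     (\<forall>x\<in>S. f differentiable (at x)) \<and>
     (\<forall>v. Ck_on k S (\<lambda>x. frechet_derivative f (at x) v))"

definition smooth_on :: "'a::real_normed_vector set \<Rightarrow> ('a \<Rightarrow> 'b::real_normed_vector) \<Rightarrow> bool" where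
  "smooth_on S f \<longleftrightarrow> (\<forall>k. Ck_on k S f)"


section \<open>Smooth manifolds\<close>

text \<open>
  A manifold of dimension \<open>CARD('n)\<close> is a type \<open>'a\<close>, Hausdorff and second countable by its
  sort, with a smooth atlas; all elements of \<open>'a\<close> are points. A chart is a pair of its domain
  and its coordinate map; the values of the map outside the domain play no role. The atlas need
  not be maximal.
\<close>

type_synonym ('a, 'n) chart = "'a set \<times> ('a \<Rightarrow> real ^ 'n)"

abbreviation cdom :: "('a, 'n) chart \<Rightarrow> 'a set" where
  "cdom c \<equiv> fst c"

abbreviation coord :: "('a, 'n) chart \<Rightarrow> 'a \<Rightarrow> real ^ 'n" where
  "coord c \<equiv> snd c"

definition cimage :: "('a, 'n) chart \<Rightarrow> (real ^ 'n) set" where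
  "cimage c = coord c ` cdom c"

definition param :: "('a, 'n) chart \<Rightarrow> real ^ 'n \<Rightarrow> 'a" where
  "param c = inv_into (cdom c) (coord c)"

definition transition :: "('a, 'n) chart \<Rightarrow> ('a, 'n) chart \<Rightarrow> real ^ 'n \<Rightarrow> real ^ 'n" where
  "transition c d = coord d \<circ> param c"

definition smooth_atlas ::
  "('a::{t2_space, second_countable_topology}, 'n::finite) chart set \<Rightarrow> bool" where
  "smooth_atlas A \<longleftrightarrow>
     (\<Union>c\<in>A. cdom c) = UNIV \<and>
     (\<forall>c\<in>A. open (cdom c) \<and> open (cimage c) \<and>
        homeomorphism (cdom c) (cimage c) (coord c) (param c)) \<and>
     (\<forall>c\<in>A. \<forall>d\<in>A. smooth_on (coord c ` (cdom c \<inter> cdom d)) (transition c d))"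


section \<open>Tangent vectors\<close>

text \<open>
  A tangent vector at \<open>p\<close> is represented by the family of its coordinate vectors in all charts of
  the atlas around \<open>p\<close>, which must transform by the Jacobians of the transition maps. Setting the
  family to zero at all other indices makes the representation unique, and turns the tangent space
  into a vector space under the pointwise operations.
\<close>

type_synonym ('a, 'n) tvec = "('a, 'n) chart \<Rightarrow> real ^ 'n"

definition tangent_space ::
  "('a, 'n::finite) chart set \<Rightarrow> 'a \<Rightarrow> ('a, 'n) tvec set" where
  "tangent_space A p = {v.
     (\<forall>c. \<not> (c \<in> A \<and> p \<in> cdom c) \<longrightarrow> v c = 0) \<and>
     (\<forall>c\<in>A. \<forall>d\<in>A. p \<in> cdom c \<longrightarrow> p \<in> cdom d \<longrightarrow>
        v d = frechet_derivative (transition c d) (at (coord c p)) (v c))}"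

text \<open>
  \<open>tvec_of A c x u\<close> is the tangent vector at the point with coordinates \<open>x\<close> in the chart \<open>c\<close>
  whose coordinate vector in \<open>c\<close> is \<open>u\<close>.
\<close>

definition tvec_of ::
  "('a, 'n::finite) chart set \<Rightarrow> ('a, 'n) chart \<Rightarrow> real ^ 'n \<Rightarrow> real ^ 'n \<Rightarrow> ('a, 'n) tvec" where
  "tvec_of A c x u =
     (\<lambda>d. if d \<in> A \<and> param c x \<in> cdom d then frechet_derivative (transition c d) (at x) u else 0)"


section \<open>Curves\<close>

definition smooth_curve ::
  "('a::topological_space, 'n::finite) chart set \<Rightarrow> real set \<Rightarrow> (real \<Rightarrow> 'a) \<Rightarrow> bool" where
  "smooth_curve A J \<gamma> \<longleftrightarrow>
     open J \<and> is_interval J \<and> continuous_on J \<gamma> \<and>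
     (\<forall>c\<in>A. smooth_on {t \<in> J. \<gamma> t \<in> cdom c} (\<lambda>t. coord c (\<gamma> t)))"

definition velocity ::
  "('a, 'n::finite) chart set \<Rightarrow> (real \<Rightarrow> 'a) \<Rightarrow> real \<Rightarrow> ('a, 'n) tvec" where
  "velocity A \<gamma> t =
     (\<lambda>c. if c \<in> A \<and> \<gamma> t \<in> cdom c then vector_derivative (\<lambda>s. coord c (\<gamma> s)) (at t) else 0)"


section \<open>Symmetric affine connections and parallel transport\<close>

text \<open>
  An affine connection is given by its Christoffel symbols in all charts: the i-th component of
  \<open>\<Gamma> c x w u\<close> is \<open>\<Sum>j k. \<Gamma>\<^sup>i\<^sub>j\<^sub>k(x) w\<^sup>j u\<^sup>k\<close>, so that the covariant derivative
  of a vector field u in direction w is \<open>Du(w) + \<Gamma>(w, u)\<close>. The last condition is the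
  transformation law of Christoffel symbols under the coordinate change \<open>transition c d\<close>.
  Symmetry in the two lower indices expresses the vanishing of the torsion.
\<close>

type_synonym ('a, 'n) connection =
  "('a, 'n) chart \<Rightarrow> real ^ 'n \<Rightarrow> real ^ 'n \<Rightarrow> real ^ 'n \<Rightarrow> real ^ 'n"

definition affine_connection ::
  "('a, 'n::finite) chart set \<Rightarrow> ('a, 'n) connection \<Rightarrow> bool" where
  "affine_connection A \<Gamma> \<longleftrightarrow>
     (\<forall>c\<in>A. \<forall>x\<in>cimage c. bilinear (\<Gamma> c x)) \<and>
     (\<forall>c\<in>A. \<forall>w u. smooth_on (cimage c) (\<lambda>x. \<Gamma> c x w u)) \<and>
     (\<forall>c\<in>A. \<forall>d\<in>A. \<forall>p \<in> cdom c \<inter> cdom d. \<forall>w u.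
        let x = coord c p; \<tau> = transition c d; D = frechet_derivative \<tau> (at x) in
        D (\<Gamma> c x w u) =
          frechet_derivative (\<lambda>y. frechet_derivative \<tau> (at y) u) (at x) w
          + \<Gamma> d (coord d p) (D w) (D u))"

definition symmetric_connection ::
  "('a, 'n::finite) chart set \<Rightarrow> ('a, 'n) connection \<Rightarrow> bool" where
  "symmetric_connection A \<Gamma> \<longleftrightarrow>
     affine_connection A \<Gamma> \<and> (\<forall>c\<in>A. \<forall>x\<in>cimage c. \<forall>w u. \<Gamma> c x w u = \<Gamma> c x u w)"

definition parallel_along ::
  "('a, 'n::finite) chart set \<Rightarrow> ('a, 'n) connection \<Rightarrow> real set \<Rightarrow> (real \<Rightarrow> 'a)
     \<Rightarrow> (real \<Rightarrow> ('a, 'n) tvec) \<Rightarrow> bool" where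
  "parallel_along A \<Gamma> J \<gamma> V \<longleftrightarrow>
     (\<forall>t\<in>J. V t \<in> tangent_space A (\<gamma> t)) \<and>
     (\<forall>t\<in>J. \<forall>c\<in>A. \<gamma> t \<in> cdom c \<longrightarrow>
        ((\<lambda>s. V s c) has_vector_derivative
          - \<Gamma> c (coord c (\<gamma> t)) (velocity A \<gamma> t c) (V t c)) (at t))"

text \<open>
  Parallel transport along \<open>\<gamma>\<close> from time \<open>s\<close> to time \<open>t\<close>, as the graph of a map between tangent
  spaces. Curves live on open intervals; a smooth curve on a closed interval is treated as the
  restriction of such a curve.
\<close>

definition parallel_transport ::
  "('a, 'n::finite) chart set \<Rightarrow> ('a, 'n) connection \<Rightarrow> real set \<Rightarrow> (real \<Rightarrow> 'a)
     \<Rightarrow> real \<Rightarrow> real \<Rightarrow> ('a, 'n) tvec \<Rightarrow> ('a, 'n) tvec \<Rightarrow> bool" where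
  "parallel_transport A \<Gamma> J \<gamma> s t v w \<longleftrightarrow>
     (\<exists>V. parallel_along A \<Gamma> J \<gamma> V \<and> V s = v \<and> V t = w)"

definition geodesic ::
  "('a::topological_space, 'n::finite) chart set \<Rightarrow> ('a, 'n) connection
     \<Rightarrow> real set \<Rightarrow> (real \<Rightarrow> 'a) \<Rightarrow> bool" where
  "geodesic A \<Gamma> J \<gamma> \<longleftrightarrow>
     smooth_curve A J \<gamma> \<and> parallel_along A \<Gamma> J \<gamma> (velocity A \<gamma>)"


section \<open>Finsler metrics\<close>

definition finsler_metric ::
  "('a, 'n::finite) chart set \<Rightarrow> ('a \<Rightarrow> ('a, 'n) tvec \<Rightarrow> real) \<Rightarrow> bool" where
  "finsler_metric A F \<longleftrightarrow>
     (\<forall>p. \<forall>v\<in>tangent_space A p. 0 \<le> F p v) \<and>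
     (\<forall>p. \<forall>v\<in>tangent_space A p. \<forall>r\<ge>0. F p (\<lambda>c. r *\<^sub>R v c) = r * F p v) \<and>
     (\<forall>p. \<forall>v\<in>tangent_space A p. \<forall>w\<in>tangent_space A p.
        F p (\<lambda>c. v c + w c) \<le> F p v + F p w) \<and>
     (\<forall>p. \<forall>v\<in>tangent_space A p. F p v = 0 \<longrightarrow> v = (\<lambda>c. 0)) \<and>
     (\<forall>c\<in>A. smooth_on (cimage c \<times> (- {0})) (\<lambda>(x, u). F (param c x) (tvec_of A c x u)))"

definition berwald_metric ::
  "('a::topological_space, 'n::finite) chart set \<Rightarrow> ('a \<Rightarrow> ('a, 'n) tvec \<Rightarrow> real) \<Rightarrow> bool" where
  "berwald_metric A F \<longleftrightarrow>
     finsler_metric A F \<and>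
     (\<exists>\<Gamma>. symmetric_connection A \<Gamma> \<and>
        (\<forall>J \<gamma> s t v w. smooth_curve A J \<gamma> \<longrightarrow> s \<in> J \<longrightarrow> t \<in> J \<longrightarrow>
           parallel_transport A \<Gamma> J \<gamma> s t v w \<longrightarrow> F (\<gamma> t) w = F (\<gamma> s) v))"

text \<open>
  The Euler--Lagrange equations \<open>d/dt (\<partial>L/\<partial>u\<^sup>i) = \<partial>L/\<partial>x\<^sup>i\<close> in every chart,
  evaluated along the coordinate expression of the curve and contracted with an arbitrary
  constant vector \<open>e\<close>.
\<close>

definition euler_lagrange ::
  "('a, 'n::finite) chart set \<Rightarrow> ('a \<Rightarrow> ('a, 'n) tvec \<Rightarrow> real) \<Rightarrow> real set \<Rightarrow> (real \<Rightarrow> 'a) \<Rightarrow> bool" where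
  "euler_lagrange A L J \<gamma> \<longleftrightarrow>
     (\<forall>t\<in>J. \<forall>c\<in>A. \<gamma> t \<in> cdom c \<longrightarrow>
        (let l = (\<lambda>x u. L (param c x) (tvec_of A c x u));
             x = (\<lambda>s. coord c (\<gamma> s));
             u = (\<lambda>s. velocity A \<gamma> s c) in
         \<forall>e. ((\<lambda>s. frechet_derivative (l (x s)) (at (u s)) e) has_real_derivative
                frechet_derivative (\<lambda>y. l y (u t)) (at (x t)) e) (at t)))"

definition finsler_geodesic ::
  "('a::topological_space, 'n::finite) chart set \<Rightarrow> ('a \<Rightarrow> ('a, 'n) tvec \<Rightarrow> real)
     \<Rightarrow> real set \<Rightarrow> (real \<Rightarrow> 'a) \<Rightarrow> bool" where
  "finsler_geodesic A F J \<gamma> \<longleftrightarrow>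
     smooth_curve A J \<gamma> \<and> (\<forall>t\<in>J. velocity A \<gamma> t \<noteq> (\<lambda>c. 0)) \<and>
     euler_lagrange A (\<lambda>p v. (F p v)\<^sup>2 / 2) J \<gamma>"


section \<open>Riemannian metrics\<close>

definition riemannian_metric ::
  "('a, 'n::finite) chart set \<Rightarrow> ('a \<Rightarrow> ('a, 'n) tvec \<Rightarrow> ('a, 'n) tvec \<Rightarrow> real) \<Rightarrow> bool" where
  "riemannian_metric A g \<longleftrightarrow>
     (\<forall>p. \<forall>v\<in>tangent_space A p. \<forall>w\<in>tangent_space A p. g p v w = g p w v) \<and>
     (\<forall>p. \<forall>v\<in>tangent_space A p. \<forall>v'\<in>tangent_space A p. \<forall>w\<in>tangent_space A p. \<forall>a b.
        g p (\<lambda>c. a *\<^sub>R v c + b *\<^sub>R v' c) w = a * g p v w + b * g p v' w) \<and>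
     (\<forall>p. \<forall>v\<in>tangent_space A p. v \<noteq> (\<lambda>c. 0) \<longrightarrow> 0 < g p v v) \<and>
     (\<forall>c\<in>A. \<forall>u w. smooth_on (cimage c)
        (\<lambda>x. g (param c x) (tvec_of A c x u) (tvec_of A c x w)))"

text \<open>The coordinate form of \<open>\<nabla>g = 0\<close>.\<close>

definition metric_connection ::
  "('a, 'n::finite) chart set \<Rightarrow> ('a \<Rightarrow> ('a, 'n) tvec \<Rightarrow> ('a, 'n) tvec \<Rightarrow> real)
     \<Rightarrow> ('a, 'n) connection \<Rightarrow> bool" where
  "metric_connection A g \<Gamma> \<longleftrightarrow>
     (\<forall>c\<in>A. \<forall>x\<in>cimage c. \<forall>w u v.
        let h = (\<lambda>y u v. g (param c y) (tvec_of A c y u) (tvec_of A c y v)) in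
        frechet_derivative (\<lambda>y. h y u v) (at x) w = h x (\<Gamma> c x w u) v + h x u (\<Gamma> c x w v))"

text \<open>
  The symmetric metric connection of a Riemannian metric is unique up to the values of \<open>\<Gamma> c x\<close>
  with \<open>c \<notin> A\<close> or \<open>x \<notin> cimage c\<close>, which have no meaning; hence choice rather than
  definite description.
\<close>

definition levi_civita ::
  "('a, 'n::finite) chart set \<Rightarrow> ('a \<Rightarrow> ('a, 'n) tvec \<Rightarrow> ('a, 'n) tvec \<Rightarrow> real)
     \<Rightarrow> ('a, 'n) connection" where
  "levi_civita A g = (SOME \<Gamma>. symmetric_connection A \<Gamma> \<and> metric_connection A g \<Gamma>)"

definition riemannian_geodesic ::
  "('a::topological_space, 'n::finite) chart set
     \<Rightarrow> ('a \<Rightarrow> ('a, 'n) tvec \<Rightarrow> ('a, 'n) tvec \<Rightarrow> real) \<Rightarrow> real set \<Rightarrow> (real \<Rightarrow> 'a) \<Rightarrow> bool" where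
  "riemannian_geodesic A g J \<gamma> \<longleftrightarrow>
     geodesic A (levi_civita A g) J \<gamma> \<and> (\<exists>s\<in>J. \<exists>t\<in>J. \<gamma> s \<noteq> \<gamma> t)"


section \<open>Affine equivalence\<close>

text \<open>
  Metrics enter only through their parametrized geodesics, so that the same notion applies to
  Finsler and to Riemannian metrics. The relation is not a priori symmetric.
\<close>

definition affine_equivalent ::
  "(real set \<Rightarrow> (real \<Rightarrow> 'a) \<Rightarrow> bool) \<Rightarrow> (real set \<Rightarrow> (real \<Rightarrow> 'a) \<Rightarrow> bool) \<Rightarrow> bool" where
  "affine_equivalent geod1 geod2 \<longleftrightarrow> (\<forall>J \<gamma>. geod1 J \<gamma> \<longrightarrow> geod2 J \<gamma>)"

end

theory Submission
  imports Defs
begin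

text \<open>
  To each (asymmetric) norm \<open>f\<close> on a finite-dimensional space assign the inner product of \<open>u\<close> and
  \<open>v\<close> given by the average of \<open>\<xi>(u) \<xi>(v)\<close> over \<open>\<xi>\<close> in the polar body of \<open>f\<close>. It is natural under linear
  isomorphisms, so applied to a Berwald metric it yields a field \<open>g\<close> of inner products that is
  invariant under the parallel transport of the associated connection \<open>\<Gamma>\<close>. Transport along
  straight segments in a chart shows that \<open>g\<close> is differentiable with \<open>\<nabla>g = 0\<close>, which by
  bootstrapping makes it smooth, and \<open>\<Gamma>\<close> is its Levi-Civita connection. It remains to see that
  the geodesics of \<open>\<Gamma>\<close> satisfy the Euler--Lagrange equations of \<open>F\<^sup>2 / 2\<close>; this again follows from
  the invariance of \<open>F\<close> under transport along segments and the symmetry of \<open>\<Gamma>\<close>.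
\<close>


section \<open>Calculus of k times continuously differentiable maps\<close>

text \<open>Strict convexity is not assumed, so the fibre Hessian of \<open>F\<^sup>2 / 2\<close>
  may degenerate: it supplies neither an inner product nor an equation that can be solved for the
  acceleration. An average over a convex body needs only the norm on a single tangent space. The
  polar body is preferred to the unit ball because its elements are covectors: their squares are
  quadratic forms on vectors, whereas averaging over the unit ball would give a form on covectors.
  Dividing by the volume cancels the determinant produced by a linear isomorphism.

  Nothing is known in advance about how this average varies with the base point. Invariance reduces
  the question to a family of linear maps \<open>Q w\<close> that pull the norm at one fixed point
  back to the norms at nearby points, and only the derivative of \<open>Q\<close> at
  \<open>w = 0\<close> matters. The same family describes how the energy varies, so the
  Euler--Lagrange equations can be checked directly along each geodesic.\<close>

lemma Ck_on_cong:
  assumes "open S" "\<And>x. x \<in> S \<Longrightarrow> f x = g x" "Ck_on k S f"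
  shows "Ck_on k S g"
  using assms(2,3)
proof (induction k arbitrary: f g)
  case 0
  then show ?case using continuous_on_cong by fastforce
next
  case (Suc k)
  have g: "(g has_derivative frechet_derivative f (at x)) (at x)" if "x \<in> S" for x
    using has_derivative_transform_within_open[OF _ assms(1) that] Suc.prems that
    by (metis Ck_on.simps(2) frechet_derivative_works)
  have "Ck_on k S (\<lambda>x. frechet_derivative g (at x) v)" for v
  proof (rule Suc.IH)
    show "Ck_on k S (\<lambda>x. frechet_derivative f (at x) v)" using Suc.prems by simp
  qed (use frechet_derivative_at[OF g] in auto)
  then show ?case using g by (auto simp: differentiable_def)
qed

lemma Ck_on_subset: "Ck_on k S f \<Longrightarrow> T \<subseteq> S \<Longrightarrow> Ck_on k T f"
  by (induction k arbitrary: f) (auto intro: continuous_on_subset)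

text \<open>A derivative at a point is unique, so an explicit formula may stand in for
  \<open>frechet_derivative\<close>. The closure rules for sums, products and compositions rest on
  this.\<close>

lemma Ck_on_Suc_I:
  assumes "open S" "\<And>x. x \<in> S \<Longrightarrow> (f has_derivative D x) (at x)" "\<And>v. Ck_on k S (\<lambda>x. D x v)"
  shows "Ck_on (Suc k) S f"
proof -
  have "D x = frechet_derivative f (at x)" if "x \<in> S" for x
    using frechet_derivative_at[OF assms(2)[OF that]] .
  then have "Ck_on k S (\<lambda>x. frechet_derivative f (at x) v)" for v
    by (intro Ck_on_cong[OF assms(1) _ assms(3)[of v]]) auto
  then show ?thesis using assms(2) by (auto simp: differentiable_def)
qed

lemma Ck_on_imp_continuous_on: "Ck_on k S f \<Longrightarrow> continuous_on S f"
  by (cases k)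
    (auto intro!: continuous_at_imp_continuous_on differentiable_imp_continuous_within)

lemma Ck_on_Suc_D: "Ck_on (Suc k) S f \<Longrightarrow> Ck_on k S f"
proof (induction k arbitrary: f)
  case 0
  then show ?case using Ck_on_imp_continuous_on by (metis Ck_on.simps(1))
next
  case (Suc k)
  then show ?case by simp
qed

lemma Ck_on_has_derivative:
  "Ck_on (Suc k) S f \<Longrightarrow> x \<in> S \<Longrightarrow> (f has_derivative frechet_derivative f (at x)) (at x)"
  using frechet_derivative_works by auto

lemma Ck_on_const: "Ck_on k S (\<lambda>x. c)"
  by (induction k arbitrary: c) auto

lemma Ck_on_add:
  assumes "open S" "Ck_on k S f" "Ck_on k S g"
  shows "Ck_on k S (\<lambda>x. f x + g x)"
  using assms(2,3)
proof (induction k arbitrary: f g)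
  case 0
  then show ?case by (auto intro: continuous_intros)
next
  case (Suc k)
  show ?case
  proof (rule Ck_on_Suc_I[OF assms(1)])
    show "((\<lambda>x. f x + g x) has_derivative
        (\<lambda>v. frechet_derivative f (at x) v + frechet_derivative g (at x) v)) (at x)"
      if "x \<in> S" for x
      using Suc.prems that by (intro has_derivative_add Ck_on_has_derivative)
  qed (use Suc in auto)
qed

lemma Ck_on_sum:
  assumes "open S" "\<And>i. i \<in> I \<Longrightarrow> Ck_on k S (f i)"
  shows "Ck_on k S (\<lambda>x. \<Sum>i\<in>I. f i x)"
  using assms(2)
  by (induction I rule: infinite_finite_induct) (auto intro: Ck_on_const Ck_on_add[OF assms(1)])

lemma Ck_on_mult:
  fixes f g :: "'a::real_normed_vector \<Rightarrow> real"
  assumes "open S" "Ck_on k S f" "Ck_on k S g"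
  shows "Ck_on k S (\<lambda>x. f x * g x)"
  using assms(2,3)
proof (induction k arbitrary: f g)
  case 0
  then show ?case by (auto intro: continuous_intros)
next
  case (Suc k)
  show ?case
  proof (rule Ck_on_Suc_I[OF assms(1)])
    show "((\<lambda>x. f x * g x) has_derivative
        (\<lambda>v. f x * frechet_derivative g (at x) v + frechet_derivative f (at x) v * g x)) (at x)"
      if "x \<in> S" for x
      using Suc.prems that by (intro has_derivative_mult Ck_on_has_derivative)
    show "Ck_on k S (\<lambda>x. f x * frechet_derivative g (at x) v + frechet_derivative f (at x) v * g x)" for v
      using Suc.prems Suc.prems[THEN Ck_on_Suc_D] by (intro Ck_on_add[OF assms(1)] Suc.IH) auto
  qed
qed

lemma Ck_on_bounded_linear:
  assumes "open S" "bounded_linear L" "Ck_on k S f"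
  shows "Ck_on k S (\<lambda>x. L (f x))"
  using assms(3)
proof (induction k arbitrary: f)
  case 0
  then show ?case using bounded_linear.continuous_on[OF assms(2)] by auto
next
  case (Suc k)
  show ?case
  proof (rule Ck_on_Suc_I[OF assms(1)])
    show "((\<lambda>x. L (f x)) has_derivative (\<lambda>v. L (frechet_derivative f (at x) v))) (at x)"
      if "x \<in> S" for x
      using Suc.prems that by (intro bounded_linear.has_derivative[OF assms(2)] Ck_on_has_derivative)
  qed (use Suc in auto)
qed

text \<open>For an affine inner map the directional derivative along \<open>v\<close> is the
  derivative of \<open>f\<close> along the fixed vector \<open>L v\<close>, composed with the same
  affine map, so the induction closes. The two uses are straight lines in a chart and the inclusion
  of a fibre \<open>u \<mapsto> (x, u)\<close>.\<close>

lemma Ck_on_compose_affine: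
  assumes "open S" "bounded_linear L" "Ck_on k S f"
  shows "Ck_on k {u. a + L u \<in> S} (\<lambda>u. f (a + L u))"
  using assms(3)
proof (induction k arbitrary: f)
  interpret bounded_linear L by fact
  have o: "open {u. a + L u \<in> S}"
    using open_vimage[OF assms(1), of "\<lambda>u. a + L u"]
    by (simp add: vimage_def continuous_intros continuous_on)
  {
    case 0
    then show ?case
      by (auto intro!: continuous_on_compose2[of S f] continuous_intros continuous_on)
  next
    case (Suc k)
    show ?case
    proof (rule Ck_on_Suc_I[OF o])
      show "((\<lambda>u. f (a + L u)) has_derivative (\<lambda>v. frechet_derivative f (at (a + L x)) (L v))) (at x)"
        if "x \<in> {u. a + L u \<in> S}" for x
      proof -
        have 1: "(f has_derivative frechet_derivative f (at (a + L x))) (at (a + L x))"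
          using Suc.prems that by (intro Ck_on_has_derivative) auto
        have 2: "((\<lambda>u. a + L u) has_derivative L) (at x)"
          by (auto intro!: derivative_eq_intros has_derivative has_derivative_ident)
        show ?thesis using has_derivative_compose[OF 2 1] .
      qed
    qed (use Suc in auto)
  }
qed

lemma smooth_on_Ck: "smooth_on S f \<Longrightarrow> Ck_on k S f"
  by (simp add: smooth_on_def)

lemma smooth_on_has_derivative:
  "smooth_on S f \<Longrightarrow> x \<in> S \<Longrightarrow> (f has_derivative frechet_derivative f (at x)) (at x)"
  using Ck_on_has_derivative smooth_on_Ck by blast

lemma smooth_on_frechet_derivative: "smooth_on S f \<Longrightarrow> smooth_on S (\<lambda>x. frechet_derivative f (at x) v)"
  unfolding smooth_on_def using Ck_on.simps(2) by blast


section \<open>Linear differential equations\<close>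

lemma vector_derivative_bound:
  fixes f :: "real \<Rightarrow> 'a::real_normed_vector"
  assumes "convex S" "\<And>t. t \<in> S \<Longrightarrow> (f has_vector_derivative f' t) (at t within S)"
    and "\<And>t. t \<in> S \<Longrightarrow> norm (f' t) \<le> M" "s \<in> S" "t \<in> S"
  shows "norm (f s - f t) \<le> M * \<bar>s - t\<bar>"
proof -
  have "onorm (\<lambda>h. h *\<^sub>R f' t) \<le> M" if "t \<in> S" for t
  proof (rule onorm_le)
    show "norm (h *\<^sub>R f' t) \<le> M * norm h" for h :: real
      using mult_left_mono[OF assms(3)[OF that], of "\<bar>h\<bar>"] by (simp add: mult.commute)
  qed
  then show ?thesis
    using differentiable_bound[OF assms(1) assms(2)[unfolded has_vector_derivative_def] _ assms(4,5)]
    by simp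
qed

text \<open>The Picard operator is a contraction on the whole interval because
  \<open>K * (b - a) < 1\<close>, so one application of Banach's fixed point theorem suffices.
  Transport along short segments meets this bound.\<close>

lemma linear_ode_exists:
  fixes B :: "real \<Rightarrow> 'a::euclidean_space \<Rightarrow> 'a"
  assumes "a \<le> b" "t0 \<in> {a..b}" "0 \<le> K" "K * (b - a) < 1"
    and lin: "\<And>t. t \<in> {a..b} \<Longrightarrow> linear (B t)"
    and cont: "\<And>v. continuous_on {a..b} (\<lambda>t. B t v)"
    and bd: "\<And>t v. t \<in> {a..b} \<Longrightarrow> norm (B t v) \<le> K * norm v"
  obtains V where "V t0 = v0" "\<And>t. t \<in> {a<..<b} \<Longrightarrow> (V has_vector_derivative B t (V t)) (at t)"
proof -
  have contB: "continuous_on {a..b} (\<lambda>t. B t (\<phi> t))" if "continuous_on {a..b} \<phi>" for \<phi>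
  proof -
    have "continuous_on {a..b} (\<lambda>t. \<Sum>i\<in>Basis. (\<phi> t \<bullet> i) *\<^sub>R B t i)"
      by (intro continuous_intros cont that)
    moreover have "(\<Sum>i\<in>Basis. (\<phi> t \<bullet> i) *\<^sub>R B t i) = B t (\<phi> t)" if "t \<in> {a..b}" for t
    proof -
      interpret linear "B t" using lin[OF that] .
      have "B t (\<phi> t) = B t (\<Sum>i\<in>Basis. (\<phi> t \<bullet> i) *\<^sub>R i)"
        by (simp add: euclidean_representation)
      then show ?thesis by (simp only: sum scale)
    qed
    ultimately show ?thesis by (rule continuous_on_eq)
  qed
  \<comment> \<open>The difference of two integrals from \<open>a\<close> is the integral from
    \<open>t0\<close> to \<open>t\<close> for either order of \<open>t0\<close> and
    \<open>t\<close>.\<close>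
  define I where "I \<phi> t = v0 + integral {a..t} (\<lambda>s. B s (\<phi> s)) - integral {a..t0} (\<lambda>s. B s (\<phi> s))"
    for \<phi> t
  have derI: "(I \<phi> has_vector_derivative B t (\<phi> t)) (at t within {a..b})"
    if "continuous_on {a..b} \<phi>" "t \<in> {a..b}" for \<phi> t
    unfolding I_def[abs_def]
    using integral_has_vector_derivative[OF contB[OF that(1)] that(2)]
    by (auto intro!: derivative_eq_intros)
  \<comment> \<open>Clamping the argument to \<open>{a..b}\<close> extends a continuous function to
    a bounded continuous one on the line; these form a complete metric space.\<close>
  have "\<exists>g :: real \<Rightarrow>\<^sub>C 'a. \<forall>x. apply_bcontfun g x = I \<phi> (clamp a b x)" for \<phi> :: "real \<Rightarrow>\<^sub>C 'a"
  proof -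
    have "continuous_on (cbox a b) (I \<phi>)"
      using has_vector_derivative_continuous[OF derI[OF continuous_on_apply_bcontfun]]
      by (simp add: continuous_on_eq_continuous_within)
    from continuous_on_cbox_bcontfunE[OF this] show ?thesis by metis
  qed
  then obtain T :: "(real \<Rightarrow>\<^sub>C 'a) \<Rightarrow> (real \<Rightarrow>\<^sub>C 'a)"
    where T: "\<And>\<phi> x. apply_bcontfun (T \<phi>) x = I \<phi> (clamp a b x)" by metis
  have "dist (T \<phi>) (T \<psi>) \<le> K * (b - a) * dist \<phi> \<psi>" for \<phi> \<psi>
  proof (rule dist_bound)
    fix x :: real
    let ?y = "clamp a b x"
    have y: "?y \<in> {a..b}" using clamp_in_interval[of a b x] assms(1) by simp
    have "norm ((I \<phi> ?y - I \<psi> ?y) - (I \<phi> t0 - I \<psi> t0)) \<le> (K * dist \<phi> \<psi>) * \<bar>?y - t0\<bar>"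
    proof (rule vector_derivative_bound[where S = "{a..b}"])
      fix t assume t: "t \<in> {a..b}"
      show "((\<lambda>t. I \<phi> t - I \<psi> t) has_vector_derivative B t (\<phi> t) - B t (\<psi> t)) (at t within {a..b})"
        by (intro has_vector_derivative_diff derI t) auto
      have "norm (B t (\<phi> t) - B t (\<psi> t)) \<le> K * norm (\<phi> t - \<psi> t)"
        using bd[OF t, of "\<phi> t - \<psi> t"] linear_diff[OF lin[OF t]] by simp
      also have "\<dots> \<le> K * dist \<phi> \<psi>"
        using dist_bounded[of \<phi> t \<psi>] assms(3) by (simp add: dist_norm mult_left_mono)
      finally show "norm (B t (\<phi> t) - B t (\<psi> t)) \<le> K * dist \<phi> \<psi>" .
    qed (use y assms in auto)
    moreover have "I \<phi> t0 - I \<psi> t0 = 0" by (simp add: I_def)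
    moreover have "(K * dist \<phi> \<psi>) * \<bar>?y - t0\<bar> \<le> (K * dist \<phi> \<psi>) * (b - a)"
      using y assms(2,3) by (intro mult_left_mono) auto
    ultimately show "dist (T \<phi> x) (T \<psi> x) \<le> K * (b - a) * dist \<phi> \<psi>"
      by (simp add: T dist_norm algebra_simps)
  qed
  then have "\<exists>!\<phi>. T \<phi> = \<phi>"
    using assms(1,3,4) by (intro banach_fix_type[of "K * (b - a)"]) auto
  then obtain \<phi> where "T \<phi> = \<phi>" by blast
  then have \<phi>: "\<phi> x = I \<phi> x" if "x \<in> {a..b}" for x
    using T[of \<phi> x] that by simp
  show ?thesis
  proof (rule that)
    show "\<phi> t0 = v0" using \<phi>[OF assms(2)] by (simp add: I_def)
    fix t assume t: "t \<in> {a<..<b}"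
    have "(\<phi> has_vector_derivative B t (\<phi> t)) (at t within {a..b})"
      using has_vector_derivative_transform[OF _ \<phi> derI[of \<phi>]] t by auto
    then show "(\<phi> has_vector_derivative B t (\<phi> t)) (at t)"
      using at_within_interior[of t "{a..b}"] t by simp
  qed
qed

section \<open>Estimates for linear and bilinear maps and for short-time transport\<close>

lemma bilinear_norm_le_sum_Basis:
  fixes h :: "'a::euclidean_space \<Rightarrow> 'b::euclidean_space \<Rightarrow> 'c::real_normed_vector"
  assumes "bilinear h"
  shows "norm (h x y) \<le> (\<Sum>i\<in>Basis. \<Sum>j\<in>Basis. norm (h i j)) * norm x * norm y"
proof -
  have "norm (h x y) = norm (h (\<Sum>i\<in>Basis. (x \<bullet> i) *\<^sub>R i) (\<Sum>j\<in>Basis. (y \<bullet> j) *\<^sub>R j))"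
    by (simp add: euclidean_representation)
  also have "\<dots> = norm (\<Sum>i\<in>Basis. \<Sum>j\<in>Basis. (x \<bullet> i) *\<^sub>R (y \<bullet> j) *\<^sub>R h i j)"
    by (simp add: bilinear_sum[OF assms] sum.cartesian_product[symmetric]
        bilinear_lmul[OF assms] bilinear_rmul[OF assms] mult_ac)
  also have "\<dots> \<le> (\<Sum>i\<in>Basis. \<Sum>j\<in>Basis. norm x * (norm y * norm (h i j)))"
    by (intro sum_norm_le order_trans[OF norm_sum] sum_mono)
      (auto intro!: mult_mono Basis_le_norm simp del: scaleR_scaleR)
  finally show ?thesis by (simp add: sum_distrib_left sum_distrib_right algebra_simps)
qed

text \<open>Continuity is assumed only for fixed arguments. The values on pairs of basis vectors
  control the whole bilinear map, and the sum of their norms is continuous in \<open>x\<close>,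
  hence bounded on a compact ball.\<close>

lemma bilinear_locally_bounded:
  fixes \<Gamma> :: "'p::euclidean_space \<Rightarrow> 'a::euclidean_space \<Rightarrow> 'b::euclidean_space \<Rightarrow> 'c::real_normed_vector"
  assumes "open S" "x0 \<in> S" "\<And>x. x \<in> S \<Longrightarrow> bilinear (\<Gamma> x)"
    and cont: "\<And>w u. continuous_on S (\<lambda>x. \<Gamma> x w u)"
  obtains \<rho> C where "\<rho> > 0" "C > 0" "cball x0 \<rho> \<subseteq> S"
    "\<And>x w u. x \<in> cball x0 \<rho> \<Longrightarrow> norm (\<Gamma> x w u) \<le> C * norm w * norm u"
proof -
  obtain \<rho> where \<rho>: "\<rho> > 0" "cball x0 \<rho> \<subseteq> S"
    using open_contains_cball assms(1,2) by metis
  define m where "m x = (\<Sum>i\<in>Basis. \<Sum>j\<in>Basis. norm (\<Gamma> x i j))" for x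
  have "continuous_on (cball x0 \<rho>) m"
    unfolding m_def by (intro continuous_intros continuous_on_subset[OF cont \<rho>(2)])
  then have "bounded (m ` cball x0 \<rho>)"
    by (intro compact_imp_bounded compact_continuous_image) auto
  then obtain C where C: "C > 0" "\<And>x. x \<in> cball x0 \<rho> \<Longrightarrow> norm (m x) \<le> C"
    using bounded_pos by (metis imageI)
  have "norm (\<Gamma> x w u) \<le> C * norm w * norm u" if x: "x \<in> cball x0 \<rho>" for x w u
  proof -
    have "norm (\<Gamma> x w u) \<le> m x * norm w * norm u"
      unfolding m_def using x \<rho>(2) assms(3) by (intro bilinear_norm_le_sum_Basis) auto
    also have "\<dots> \<le> C * norm w * norm u"
      using C(2)[OF x] by (intro mult_right_mono) auto
    finally show ?thesis .
  qed
  then show ?thesis using that \<rho> C(1) by blast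
qed


text \<open>Integrating backwards, \<open>V 0\<close> is \<open>u\<close> plus the integral of
  \<open>G t (V t)\<close>. Replacing \<open>V t\<close> by \<open>u\<close> costs a term quadratic
  in \<open>k\<close>, and replacing \<open>G t u\<close> by \<open>G0\<close> costs
  \<open>\<eta>\<close>. With \<open>k\<close> proportional to the length of a segment this is a
  first-order expansion of transport.\<close>

lemma ode_unit_time_estimate:
  fixes G :: "real \<Rightarrow> 'a::real_normed_vector \<Rightarrow> 'a"
  assumes V: "\<And>t. t \<in> {0..1} \<Longrightarrow> (V has_vector_derivative - G t (V t)) (at t)" and "V 1 = u"
    and lin: "\<And>t. t \<in> {0..1} \<Longrightarrow> linear (G t)"
    and k: "\<And>t v. t \<in> {0..1} \<Longrightarrow> norm (G t v) \<le> k * norm v" "0 \<le> k" "k \<le> 1/2"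
    and \<eta>: "\<And>t. t \<in> {0..1} \<Longrightarrow> norm (G t u - G0) \<le> \<eta>"
  shows "norm (V 0 - u - G0) \<le> 2 * k\<^sup>2 * norm u + \<eta>"
proof -
  have V': "(V has_vector_derivative - G t (V t)) (at t within {0..1})" if "t \<in> {0..1}" for t
    using V[OF that] by (rule has_vector_derivative_at_within)
  \<comment> \<open>The a priori bound comes from a time \<open>\<tau>\<close> where the norm is
    largest: \<open>k \<le> 1/2\<close> lets half of \<open>norm (V \<tau>)\<close> be absorbed,
    which leaves \<open>2 * norm u\<close>.\<close>
  have "continuous_on {0..1} (\<lambda>t. norm (V t))"
    using V' by (intro continuous_on_norm continuous_on_vector_derivative)
  then obtain \<tau> where \<tau>: "\<tau> \<in> {0..1}" "\<And>t. t \<in> {0..1} \<Longrightarrow> norm (V t) \<le> norm (V \<tau>)"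
    using continuous_attains_sup[of "{0..1::real}"]
    by (metis atLeastAtMost_iff compact_Icc empty_iff zero_less_one_class.zero_le_one order_refl)
  have near: "norm (V t - u) \<le> k * norm (V \<tau>)" if t: "t \<in> {0..1}" for t
  proof -
    have "norm (V t - V 1) \<le> k * norm (V \<tau>) * \<bar>t - 1\<bar>"
    proof (rule vector_derivative_bound[OF _ V'])
      fix s :: real assume s: "s \<in> {0..1}"
      show "norm (- G s (V s)) \<le> k * norm (V \<tau>)"
        using k(1)[OF s, of "V s"] mult_left_mono[OF \<tau>(2)[OF s] k(2)] by simp
    qed (use t in auto)
    also have "\<dots> \<le> k * norm (V \<tau>) * 1"
      using t k(2) by (intro mult_left_mono) auto
    finally show ?thesis using assms(2) by simp
  qed
  have "norm (V \<tau>) \<le> norm u + norm (V \<tau> - u)" by (metis norm_triangle_sub)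
  also have "\<dots> \<le> norm u + norm (V \<tau>) / 2"
    using near[OF \<tau>(1)] mult_right_mono[OF k(3), of "norm (V \<tau>)"] by simp
  finally have "norm (V \<tau>) \<le> 2 * norm u" by simp
  then have near': "norm (V t - u) \<le> k * (2 * norm u)" if "t \<in> {0..1}" for t
    using near[OF that] mult_left_mono[OF _ k(2)] by (meson order_trans)
  \<comment> \<open>Adding \<open>t *\<^sub>R G0\<close> to \<open>V t\<close> makes the error a
    difference of end values, so the mean value inequality applies.\<close>
  have "norm ((V 0 + 0 *\<^sub>R G0) - (V 1 + 1 *\<^sub>R G0)) \<le> (2 * k\<^sup>2 * norm u + \<eta>) * \<bar>0 - 1\<bar>"
  proof (rule vector_derivative_bound[where S = "{0..1::real}"])
    fix t :: real assume t: "t \<in> {0..1}"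
    show "((\<lambda>t. V t + t *\<^sub>R G0) has_vector_derivative - G t (V t) + G0) (at t within {0..1})"
      by (rule derivative_eq_intros V'[OF t] refl)+ simp
    have "- G t (V t) + G0 = - (G t (V t - u) + (G t u - G0))"
      using linear_diff[OF lin[OF t]] by simp
    then have "norm (- G t (V t) + G0) \<le> norm (G t (V t - u)) + norm (G t u - G0)"
      by (metis norm_minus_cancel norm_triangle_ineq)
    also have "\<dots> \<le> k * (k * (2 * norm u)) + \<eta>"
      using k(1)[OF t, of "V t - u"] mult_left_mono[OF near'[OF t] k(2)] \<eta>[OF t] by simp
    finally show "norm (- G t (V t) + G0) \<le> 2 * k\<^sup>2 * norm u + \<eta>"
      by (simp add: power2_eq_square algebra_simps)
  qed auto
  then show ?thesis using assms(2) by (simp add: algebra_simps)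
qed

lemma linear_norm_le_sum_Basis:
  fixes L :: "'a::euclidean_space \<Rightarrow> 'b::real_normed_vector"
  assumes "linear L"
  shows "norm (L w) \<le> (\<Sum>i\<in>Basis. norm (L i)) * norm w"
proof -
  have "norm (L w) = norm (\<Sum>i\<in>Basis. (w \<bullet> i) *\<^sub>R L i)"
    using assms by (metis (no_types, lifting) euclidean_representation linear_cmul linear_sum sum.cong)
  also have "\<dots> \<le> (\<Sum>i\<in>Basis. norm (L i) * norm w)"
    by (intro sum_norm_le) (simp add: mult.commute[of "norm (L _)"] mult_right_mono Basis_le_norm)
  finally show ?thesis by (simp add: sum_distrib_right)
qed

text \<open>
  \<open>Q w\<close> is parallel transport from \<open>x0 + w\<close> to \<open>x0\<close> along the segment between them. Working with
  the directed segments makes \<open>Q\<close> differentiable in the end point \<open>w\<close> at \<open>w = 0\<close> without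
  any theorem on the dependence of solutions on parameters.
\<close>

lemma line_transport:
  fixes \<Gamma> :: "'a::euclidean_space \<Rightarrow> 'a \<Rightarrow> 'a \<Rightarrow> 'a"
  assumes "open S" "x0 \<in> S" and bil: "\<And>x. x \<in> S \<Longrightarrow> bilinear (\<Gamma> x)"
    and cont: "\<And>w u. continuous_on S (\<lambda>x. \<Gamma> x w u)"
  obtains r Q where "r > 0"
    "\<And>w t. norm w < r \<Longrightarrow> t \<in> {-1<..<2} \<Longrightarrow> x0 + t *\<^sub>R w \<in> S"
    "\<And>w. norm w < r \<Longrightarrow> linear (Q w)"
    "\<And>w u. norm w < r \<Longrightarrow> \<exists>V. V 1 = u \<and> V 0 = Q w u \<and>
       (\<forall>t\<in>{-1<..<2::real}. (V has_vector_derivative - \<Gamma> (x0 + t *\<^sub>R w) w (V t)) (at t))"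
    "\<And>u. Q 0 u = u"
    "\<And>u. ((\<lambda>w. Q w u) has_derivative (\<lambda>w. \<Gamma> x0 w u)) (at 0)"
proof -
  obtain \<rho> C where \<rho>: "\<rho> > 0" "cball x0 \<rho> \<subseteq> S" and C: "C > 0"
    "\<And>x w u. x \<in> cball x0 \<rho> \<Longrightarrow> norm (\<Gamma> x w u) \<le> C * norm w * norm u"
    using bilinear_locally_bounded[OF assms(1,2) bil cont] by metis
  \<comment> \<open>Times reach 2 in absolute value, hence \<open>\<rho> / 2\<close>. The other
    bound gives \<open>C * norm w < 1/4\<close>, which makes the contraction constant on an interval
    of length 3 less than 1 and also meets \<open>k \<le> 1/2\<close>. The open interval around
    \<open>{0..1}\<close> is chosen because curves live on open intervals.\<close>
  define r where "r = min (\<rho> / 2) (1 / (4 * C))"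
  have "r > 0" using \<rho> C by (simp add: r_def)
  have Cw: "C * norm w < 1/4" if "norm w < r" for w :: 'a
    using that C(1) by (simp add: r_def field_simps)
  have seg: "x0 + t *\<^sub>R w \<in> cball x0 \<rho>" if "norm w < r" "t \<in> {-1..2}" for w t
  proof -
    have "\<bar>t\<bar> * norm w \<le> 2 * (\<rho> / 2)"
      using that by (intro mult_mono) (auto simp: r_def)
    then show ?thesis by (simp add: dist_norm)
  qed
  have segS: "x0 + t *\<^sub>R w \<in> S" if "norm w < r" "t \<in> {-1..2}" for w t
    using seg[OF that] \<rho>(2) by blast
  have lin: "linear (\<Gamma> x w)" if "x \<in> S" for x w
    using bil[OF that] by (simp add: bilinear_def)
  have "\<exists>V. V 1 = u \<and> (\<forall>t\<in>{-1<..<2::real}. (V has_vector_derivative - \<Gamma> (x0 + t *\<^sub>R w) w (V t)) (at t))"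
    if w: "norm w < r" for w u
  proof (rule linear_ode_exists[of "-1" 2 1 "C * norm w" "\<lambda>t v. - \<Gamma> (x0 + t *\<^sub>R w) w v" u])
    fix t :: real assume t: "t \<in> {-1..2}"
    show "linear (\<lambda>v. - \<Gamma> (x0 + t *\<^sub>R w) w v)"
      using lin[OF segS[OF w t]] by (rule linear_compose_neg)
    show "norm (- \<Gamma> (x0 + t *\<^sub>R w) w v) \<le> C * norm w * norm v" for v
      using C(2)[OF seg[OF w t]] by simp
  next
    show "continuous_on {-1..2} (\<lambda>t. - \<Gamma> (x0 + t *\<^sub>R w) w v)" for v
      by (intro continuous_on_minus continuous_on_compose2[OF cont])
        (auto intro!: continuous_intros segS w)
  qed (use C Cw[OF w] in \<open>auto\<close>)
  then obtain V where V: "\<And>w u. norm w < r \<Longrightarrow> V w u 1 = u"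
    "\<And>w u t. norm w < r \<Longrightarrow> t \<in> {-1<..<2::real} \<Longrightarrow>
       (V w u has_vector_derivative - \<Gamma> (x0 + t *\<^sub>R w) w (V w u t)) (at t)"
    by metis
  \<comment> \<open>The solutions \<open>V w u\<close> are chosen separately for each
    \<open>u\<close>, so their dependence on \<open>u\<close> is unknown. Superposing those with
    basis vectors as final values makes the result linear in \<open>u\<close> by
    construction.\<close>
  define W where "W w u t = (\<Sum>i\<in>Basis. (u \<bullet> i) *\<^sub>R V w i t)" for w u t
  have W1: "W w u 1 = u" if "norm w < r" for w u
    using V(1)[OF that] by (simp add: W_def euclidean_representation)
  have WD: "(W w u has_vector_derivative - \<Gamma> (x0 + t *\<^sub>R w) w (W w u t)) (at t)"
    if w: "norm w < r" and t: "t \<in> {-1<..<2::real}" for w u t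
  proof -
    have x: "x0 + t *\<^sub>R w \<in> S" using segS[OF w] t by auto
    have "(W w u has_vector_derivative
        (\<Sum>i\<in>Basis. (u \<bullet> i) *\<^sub>R - \<Gamma> (x0 + t *\<^sub>R w) w (V w i t))) (at t)"
      unfolding W_def[abs_def]
      by (intro has_vector_derivative_sum bounded_linear.has_vector_derivative[OF bounded_linear_scaleR_right]
          V(2)[OF w t])
    also have "(\<Sum>i\<in>Basis. (u \<bullet> i) *\<^sub>R - \<Gamma> (x0 + t *\<^sub>R w) w (V w i t))
        = - \<Gamma> (x0 + t *\<^sub>R w) w (W w u t)"
      by (simp add: W_def linear_sum[OF lin[OF x]] linear_cmul[OF lin[OF x]] sum_negf)
    finally show ?thesis .
  qed
  define Q where "Q w u = W w u 0" for w u
  have est: "norm (Q w u - u - \<Gamma> x0 w u) \<le> 2 * (C * norm w)\<^sup>2 * norm u + \<eta>"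
    if w: "norm w < r" and \<eta>: "\<And>t. t \<in> {0..1} \<Longrightarrow> norm (\<Gamma> (x0 + t *\<^sub>R w) w u - \<Gamma> x0 w u) \<le> \<eta>"
    for w u \<eta>
    unfolding Q_def
  proof (rule ode_unit_time_estimate[where G = "\<lambda>t. \<Gamma> (x0 + t *\<^sub>R w) w"])
    fix t :: real assume t: "t \<in> {0..1}"
    show "(W w u has_vector_derivative - \<Gamma> (x0 + t *\<^sub>R w) w (W w u t)) (at t)"
      using WD[OF w] t by auto
    show "linear (\<Gamma> (x0 + t *\<^sub>R w) w)" using lin segS[OF w] t by auto
    show "norm (\<Gamma> (x0 + t *\<^sub>R w) w v) \<le> C * norm w * norm v" for v
      using C(2) seg[OF w] t by auto
  qed (use W1[OF w] Cw[OF w] C(1) \<eta> in auto)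
  have Q0: "Q 0 u = u" for u
    using est[of 0 u 0] \<open>r > 0\<close> bilinear_lzero[OF bil[OF assms(2)]] by simp
  have "((\<lambda>w. Q w u) has_derivative (\<lambda>w. \<Gamma> x0 w u)) (at 0)" for u
    unfolding has_derivative_at_alt
  proof (intro conjI allI impI)
    have linu: "linear (\<lambda>w. \<Gamma> x w u)" if "x \<in> S" for x
      using bil[OF that] by (simp add: bilinear_def)
    show "bounded_linear (\<lambda>w. \<Gamma> x0 w u)"
      using linu[OF assms(2)] by (simp add: linear_linear)
    fix e :: real assume e: "e > 0"
    \<comment> \<open>\<open>m x\<close> bounds the linear map
      \<open>\<Gamma> x - \<Gamma> x0\<close> with second argument \<open>u\<close> uniformly in the
      direction \<open>w\<close>, and \<open>m x0 = 0\<close>.\<close>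
    define m where "m x = (\<Sum>i\<in>Basis. norm (\<Gamma> x i u - \<Gamma> x0 i u))" for x
    have "continuous_on S m"
      unfolding m_def by (intro continuous_intros cont)
    then obtain \<delta> where \<delta>: "\<delta> > 0" "\<And>x. x \<in> S \<Longrightarrow> dist x x0 < \<delta> \<Longrightarrow> dist (m x) (m x0) < e / 2"
      unfolding continuous_on_iff using assms(2) e by (metis half_gt_zero)
    \<comment> \<open>Chosen so that \<open>norm w \<le> e / D\<close> turns the quadratic error
      into at most \<open>e / 2 * norm w\<close>; the \<open>+ 1\<close> keeps \<open>D\<close>
      positive for \<open>u = 0\<close>.\<close>
    define D where "D = 4 * C\<^sup>2 * (norm u + 1)"
    have D: "D > 0" using C(1) by (simp add: D_def add_nonneg_pos)
    define d where "d = Min {r, \<delta>, e / D}"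
    have d: "d > 0" "d \<le> r" "d \<le> \<delta>" "d \<le> e / D" using \<open>r > 0\<close> \<delta>(1) e D by (auto simp: d_def)
    show "\<exists>d>0. \<forall>w. norm (w - 0) < d \<longrightarrow> norm (Q w u - Q 0 u - \<Gamma> x0 (w - 0) u) \<le> e * norm (w - 0)"
    proof (intro exI conjI allI impI)
      fix w :: 'a assume "norm (w - 0) < d"
      then have w: "norm w < r" "norm w < \<delta>" "norm w \<le> e / D" using d by auto
      have "norm (Q w u - u - \<Gamma> x0 w u) \<le> 2 * (C * norm w)\<^sup>2 * norm u + e / 2 * norm w"
      proof (rule est[OF w(1)])
        fix t :: real assume t: "t \<in> {0..1}"
        let ?x = "x0 + t *\<^sub>R w"
        have x: "?x \<in> S" using segS[OF w(1)] t by auto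
        have "\<bar>t\<bar> * norm w \<le> 1 * norm w" using t by (intro mult_right_mono) auto
        then have "dist ?x x0 < \<delta>" using w(2) by (simp add: dist_norm)
        then have m: "m ?x \<le> e / 2"
          using \<delta>(2)[OF x] by (simp add: m_def dist_real_def)
        have "norm (\<Gamma> ?x w u - \<Gamma> x0 w u) \<le> m ?x * norm w"
          unfolding m_def
          by (rule linear_norm_le_sum_Basis[OF linear_compose_sub[OF linu[OF x] linu[OF assms(2)]]])
        also have "\<dots> \<le> e / 2 * norm w" using m by (intro mult_right_mono) auto
        finally show "norm (\<Gamma> ?x w u - \<Gamma> x0 w u) \<le> e / 2 * norm w" .
      qed
      moreover have "2 * (C * norm w)\<^sup>2 * norm u \<le> e / 2 * norm w"
      proof -
        have "2 * (C * norm w)\<^sup>2 * norm u \<le> 2 * (C * norm w)\<^sup>2 * (norm u + 1)"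
          by (intro mult_left_mono) auto
        also have "\<dots> = D / 2 * norm w * norm w" by (simp add: D_def power2_eq_square)
        also have "\<dots> \<le> D / 2 * (e / D) * norm w"
          using w(3) D by (intro mult_right_mono mult_left_mono) auto
        finally show ?thesis using D by simp
      qed
      ultimately show "norm (Q w u - Q 0 u - \<Gamma> x0 (w - 0) u) \<le> e * norm (w - 0)"
        by (simp add: Q0)
    qed (use d in auto)
  qed
  moreover have "linear (Q w)" for w
    by (rule linearI)
      (auto simp: Q_def W_def inner_add_left scaleR_add_left sum.distrib scaleR_sum_right)
  ultimately show ?thesis
    using that[of r Q] \<open>r > 0\<close> segS WD W1 Q0 unfolding Q_def by fastforce
qed


section \<open>Invariant inner products from norms\<close>

definition minkowski_norm :: "('a::real_vector \<Rightarrow> real) \<Rightarrow> bool" where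
  "minkowski_norm f \<longleftrightarrow>
     (\<forall>u. 0 \<le> f u) \<and> (\<forall>r\<ge>0. \<forall>u. f (r *\<^sub>R u) = r * f u) \<and>
     (\<forall>u v. f (u + v) \<le> f u + f v) \<and> (\<forall>u. f u = 0 \<longrightarrow> u = 0)"

lemma minkowski_norm_compose:
  assumes "minkowski_norm f" "linear T" "inj T"
  shows "minkowski_norm (\<lambda>u. f (T u))"
proof -
  have "T u = 0 \<Longrightarrow> u = 0" for u
    using assms(2,3) by (metis linear_injective_0)
  then show ?thesis
    using assms(1) by (auto simp: minkowski_norm_def linear_cmul[OF assms(2)] linear_add[OF assms(2)])
qed

lemma minkowski_norm_zero: "minkowski_norm f \<Longrightarrow> f 0 = 0"
  unfolding minkowski_norm_def by (metis mult_zero_left order_refl scale_zero_left)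

lemma minkowski_norm_pos: "minkowski_norm f \<Longrightarrow> u \<noteq> 0 \<Longrightarrow> 0 < f u"
  unfolding minkowski_norm_def by (metis order_le_less)

lemma minkowski_norm_upper:
  fixes f :: "'a::euclidean_space \<Rightarrow> real"
  assumes "minkowski_norm f"
  obtains M where "M > 0" "\<And>u. f u \<le> M * norm u"
proof -
  \<comment> \<open>Both \<open>f i\<close> and \<open>f (- i)\<close> occur because
    \<open>f\<close> need not be even: the sign of a coordinate decides which one is used. The
    \<open>+ 1\<close> makes positivity immediate.\<close>
  define M where "M = (\<Sum>i\<in>Basis. f i + f (- i)) + 1"
  have nn: "0 \<le> f u" for u using assms by (simp add: minkowski_norm_def)
  have "f u \<le> M * norm u" for u
  proof -
    have sub: "f (sum g B) \<le> (\<Sum>i\<in>B. f (g i))" for g :: "'a \<Rightarrow> 'a" and B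
    proof (induction B rule: infinite_finite_induct)
      case (insert x B)
      have "f (g x + sum g B) \<le> f (g x) + f (sum g B)"
        using assms by (simp add: minkowski_norm_def)
      then show ?case using insert by simp
    qed (auto simp: minkowski_norm_zero[OF assms])
    have 1: "f ((u \<bullet> i) *\<^sub>R i) \<le> norm u * (f i + f (- i))" if "i \<in> Basis" for i
    proof -
      have hom: "f (r *\<^sub>R v) = r * f v" if "r \<ge> 0" for r v
        using assms that by (simp add: minkowski_norm_def)
      have "f ((u \<bullet> i) *\<^sub>R i) \<le> \<bar>u \<bullet> i\<bar> * (f i + f (- i))"
      proof (cases "0 \<le> u \<bullet> i")
        case True
        then show ?thesis using hom[of "u \<bullet> i" i] nn[of "- i"] by (simp add: algebra_simps)
      next
        case False
        then show ?thesis
          using hom[of "- (u \<bullet> i)" "- i"] nn[of i] mult_nonpos_nonneg[of "u \<bullet> i" "f i"]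
          by (simp add: algebra_simps)
      qed
      also have "\<dots> \<le> norm u * (f i + f (- i))"
        using that nn[of i] nn[of "- i"] by (intro mult_right_mono) (auto simp: Basis_le_norm)
      finally show ?thesis .
    qed
    have "f u = f (\<Sum>i\<in>Basis. (u \<bullet> i) *\<^sub>R i)" by (simp add: euclidean_representation)
    also have "\<dots> \<le> (\<Sum>i\<in>Basis. f ((u \<bullet> i) *\<^sub>R i))" by (rule sub)
    also have "\<dots> \<le> (\<Sum>i\<in>Basis. norm u * (f i + f (- i)))" by (rule sum_mono[OF 1])
    also have "\<dots> \<le> M * norm u" by (simp add: M_def sum_distrib_left algebra_simps)
    finally show ?thesis .
  qed
  moreover have "M > 0" by (auto simp: M_def intro!: add_nonneg_pos sum_nonneg add_nonneg_nonneg nn)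
  ultimately show ?thesis using that by blast
qed

lemma minkowski_norm_continuous:
  fixes f :: "'a::euclidean_space \<Rightarrow> real"
  assumes "minkowski_norm f"
  shows "continuous_on UNIV f"
proof -
  obtain M where M: "M > 0" "\<And>u. f u \<le> M * norm u"
    using minkowski_norm_upper[OF assms] by blast
  have "dist (f u) (f v) \<le> M * dist u v" for u v
  proof -
    have "f u \<le> f (u - v) + f v" "f v \<le> f (v - u) + f u"
      using assms unfolding minkowski_norm_def by (metis diff_add_cancel)+
    then show ?thesis
      using M(2)[of "u - v"] M(2)[of "v - u"]
      by (simp add: dist_norm norm_minus_commute abs_le_iff)
  qed
  then have "M-lipschitz_on UNIV f" using M(1) by (intro lipschitz_onI) auto
  then show ?thesis by (rule lipschitz_on_continuous_on)
qed

lemma minkowski_norm_lower: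
  fixes f :: "'a::euclidean_space \<Rightarrow> real"
  assumes "minkowski_norm f"
  obtains m where "m > 0" "\<And>u. m * norm u \<le> f u"
proof -
  have "compact (sphere (0::'a) 1)" "sphere (0::'a) 1 \<noteq> {}" by auto
  then obtain x where x: "x \<in> sphere 0 1" "\<And>y. y \<in> sphere 0 1 \<Longrightarrow> f x \<le> f y"
    using continuous_attains_inf[of "sphere (0::'a) 1" f]
      continuous_on_subset[OF minkowski_norm_continuous[OF assms]] by blast
  have "f x * norm u \<le> f u" for u
  proof (cases "u = 0")
    case False
    have "f x \<le> f ((1 / norm u) *\<^sub>R u)" by (rule x(2)) (simp add: False)
    also have "\<dots> = f u / norm u" using assms by (simp add: minkowski_norm_def)
    finally show ?thesis using False by (simp add: field_simps)
  qed (simp add: minkowski_norm_zero[OF assms])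
  moreover have "f x > 0" using x(1) by (intro minkowski_norm_pos[OF assms]) auto
  ultimately show ?thesis using that by blast
qed

section \<open>Polar bodies\<close>

definition polar :: "('a::real_inner \<Rightarrow> real) \<Rightarrow> 'a set" where
  "polar f = {\<xi>. \<forall>u. \<xi> \<bullet> u \<le> f u}"

text \<open>Testing \<open>\<xi>\<close> against itself bounds its norm by the upper constant of
  \<open>f\<close>; closedness holds because the body is an intersection of half-spaces.\<close>

lemma compact_polar:
  fixes f :: "'a::euclidean_space \<Rightarrow> real"
  assumes "minkowski_norm f"
  shows "compact (polar f)"
proof -
  obtain M where M: "M > 0" "\<And>u. f u \<le> M * norm u"
    using minkowski_norm_upper[OF assms] by blast
  have "norm \<xi> \<le> M" if "\<xi> \<in> polar f" for \<xi>
  proof (cases "\<xi> = 0")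
    case False
    have "\<xi> \<bullet> \<xi> \<le> M * norm \<xi>" using that M(2)[of \<xi>] by (auto simp: polar_def intro: order_trans)
    then have "norm \<xi> * norm \<xi> \<le> M * norm \<xi>"
      by (simp add: dot_square_norm power2_eq_square)
    then show ?thesis using False by simp
  qed (use M in auto)
  then have "bounded (polar f)" by (auto simp: bounded_iff)
  moreover have "polar f = (\<Inter>u. {\<xi>. u \<bullet> \<xi> \<le> f u})"
    by (auto simp: polar_def inner_commute)
  then have "closed (polar f)" by (auto intro!: closed_INT closed_halfspace_le)
  ultimately show ?thesis by (simp add: compact_eq_bounded_closed)
qed

text \<open>By Cauchy--Schwarz the lower constant of \<open>f\<close> is the radius of such a ball.
  The ball keeps the volume and the second moments of the polar body positive.\<close>

lemma polar_contains_cball: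
  fixes f :: "'a::euclidean_space \<Rightarrow> real"
  assumes "minkowski_norm f"
  obtains m where "m > 0" "cball 0 m \<subseteq> polar f"
proof -
  obtain m where m: "m > 0" "\<And>u. m * norm u \<le> f u"
    using minkowski_norm_lower[OF assms] by blast
  have "\<xi> \<bullet> u \<le> f u" if "norm \<xi> \<le> m" for \<xi> u
  proof -
    have "\<xi> \<bullet> u \<le> norm \<xi> * norm u" by (rule norm_cauchy_schwarz)
    also have "\<dots> \<le> m * norm u" using that by (intro mult_right_mono) auto
    finally show ?thesis using m(2)[of u] by simp
  qed
  then have "cball 0 m \<subseteq> polar f" by (auto simp: polar_def)
  then show ?thesis using that m(1) by blast
qed

section \<open>Integrals over compact sets and second moments of the polar body\<close>

lemma absolutely_integrable_on_compact:
  fixes h :: "'a::euclidean_space \<Rightarrow> 'b::{banach, second_countable_topology}"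
  assumes "compact S" "continuous_on S h"
  shows "h absolutely_integrable_on S"
  using borel_integrable_compact[OF assms]
  by (simp add: set_integrable_def integrable_completion borel_measurable_integrable)

lemma integrable_on_compact:
  fixes h :: "'a::euclidean_space \<Rightarrow> 'b::euclidean_space"
  shows "compact S \<Longrightarrow> continuous_on S h \<Longrightarrow> h integrable_on S"
  by (rule set_lebesgue_integral_eq_integral(1)[OF absolutely_integrable_on_compact])

lemma integral_pos_of_ball:
  fixes h :: "'a::euclidean_space \<Rightarrow> real"
  assumes "compact S" "continuous_on S h" "\<And>x. x \<in> S \<Longrightarrow> 0 \<le> h x"
    and "cball a r \<subseteq> S" "r > 0" "c > 0" "\<And>x. x \<in> cball a r \<Longrightarrow> c \<le> h x"
  shows "0 < integral S h"
proof -
  have "0 < c * measure lborel (ball a r)" using assms by (simp add: content_ball_pos)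
  also have "\<dots> \<le> c * measure lebesgue (cball a r)"
  proof (intro mult_left_mono)
    have "measure lebesgue (ball a r) \<le> measure lebesgue (cball a r)"
      by (intro measure_mono_fmeasurable ball_subset_cball) auto
    then show "measure lborel (ball a r) \<le> measure lebesgue (cball a r)"
      by (simp add: measure_completion)
  qed (use assms(6) in simp)
  also have "\<dots> = integral (cball a r) (\<lambda>x. c)"
    using integral_mult_right[of "cball a r" c "\<lambda>x. 1 :: real"] lmeasure_integral[OF lmeasurable_cball, of a r]
    by simp
  also have "\<dots> \<le> integral (cball a r) h"
    using assms by (intro integral_le integrable_on_compact continuous_on_subset[OF assms(2)]) auto
  also have "\<dots> \<le> integral S h"
    using assms by (intro integral_subset_le integrable_on_compact continuous_on_subset[OF assms(2)]) auto
  finally show ?thesis .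
qed

text \<open>This is the second moment form of the polar body, with covectors identified with vectors
  by the Euclidean inner product. The quotient is what makes it independent of that
  identification.\<close>

definition polar_form :: "('a::euclidean_space \<Rightarrow> real) \<Rightarrow> 'a \<Rightarrow> 'a \<Rightarrow> real" where
  "polar_form f u v =
     integral (polar f) (\<lambda>\<xi>. (\<xi> \<bullet> u) * (\<xi> \<bullet> v)) / integral (polar f) (\<lambda>\<xi>. 1)"

lemma polar_form_commute: "polar_form f u v = polar_form f v u"
  by (simp add: polar_form_def mult.commute)

lemma polar_form_linear_left:
  assumes "minkowski_norm f"
  shows "polar_form f (a *\<^sub>R u + b *\<^sub>R v) w = a * polar_form f u w + b * polar_form f v w"
proof -
  have int: "(\<lambda>\<xi>. c * ((\<xi> \<bullet> u) * (\<xi> \<bullet> w))) integrable_on polar f" for u c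
    by (intro integrable_on_compact compact_polar[OF assms] continuous_intros)
  have "integral (polar f) (\<lambda>\<xi>. (\<xi> \<bullet> (a *\<^sub>R u + b *\<^sub>R v)) * (\<xi> \<bullet> w))
      = integral (polar f) (\<lambda>\<xi>. a * ((\<xi> \<bullet> u) * (\<xi> \<bullet> w)) + b * ((\<xi> \<bullet> v) * (\<xi> \<bullet> w)))"
    by (simp add: inner_add_right algebra_simps)
  also have "\<dots> = a * integral (polar f) (\<lambda>\<xi>. (\<xi> \<bullet> u) * (\<xi> \<bullet> w))
      + b * integral (polar f) (\<lambda>\<xi>. (\<xi> \<bullet> v) * (\<xi> \<bullet> w))"
    by (simp add: Henstock_Kurzweil_Integration.integral_add[OF int int])
  finally show ?thesis by (simp add: polar_form_def add_divide_distrib)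
qed

lemma polar_form_pos:
  assumes "minkowski_norm f" "u \<noteq> 0"
  shows "0 < polar_form f u u"
proof -
  obtain m where m: "m > 0" "cball 0 m \<subseteq> polar f"
    using polar_contains_cball[OF assms(1)] by blast
  have "0 < integral (polar f) (\<lambda>\<xi>. 1 :: real)"
    using m by (intro integral_pos_of_ball[of _ _ 0 m 1] compact_polar assms) auto
  moreover have "0 < integral (polar f) (\<lambda>\<xi>. (\<xi> \<bullet> u) * (\<xi> \<bullet> u))"
  proof (rule integral_pos_of_ball[of _ _ "(m / (2 * norm u)) *\<^sub>R u" "m / 4" "(m / 4 * norm u)\<^sup>2"])
    \<comment> \<open>The centre lies at distance \<open>m / 2\<close> from the origin in direction
      \<open>u\<close>. A ball of radius \<open>m / 4\<close> around it stays in the polar body and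
      satisfies \<open>\<xi> \<bullet> u \<ge> (m / 2 - m / 4) * norm u\<close>.\<close>
    let ?a = "(m / (2 * norm u)) *\<^sub>R u"
    have na: "norm ?a = m / 2" using assms(2) m(1) by simp
    have "norm \<xi> \<le> m" if "dist ?a \<xi> \<le> m / 4" for \<xi>
    proof -
      have "norm \<xi> \<le> norm ?a + norm (?a - \<xi>)" by (metis norm_minus_commute norm_triangle_sub)
      then show ?thesis using that na m(1) by (simp add: dist_norm)
    qed
    then show "cball ?a (m / 4) \<subseteq> polar f" using m(2) by auto
    fix \<xi> assume "\<xi> \<in> cball ?a (m / 4)"
    then have d: "norm (?a - \<xi>) \<le> m / 4" by (simp add: dist_norm)
    have "(?a - \<xi>) \<bullet> u \<le> norm (?a - \<xi>) * norm u" by (rule norm_cauchy_schwarz)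
    also have "\<dots> \<le> m / 4 * norm u" by (rule mult_right_mono[OF d norm_ge_zero])
    finally have "?a \<bullet> u - m / 4 * norm u \<le> \<xi> \<bullet> u" unfolding inner_diff_left by linarith
    moreover have "?a \<bullet> u = m / 2 * norm u"
      using assms(2) by (simp add: dot_square_norm power2_eq_square)
    ultimately have "m / 4 * norm u \<le> \<xi> \<bullet> u" by linarith
    then show "(m / 4 * norm u)\<^sup>2 \<le> (\<xi> \<bullet> u) * (\<xi> \<bullet> u)"
      unfolding power2_eq_square using m(1) by (intro mult_mono') auto
  qed (use m assms compact_polar in \<open>auto intro!: continuous_intros\<close>)
  ultimately show ?thesis by (simp add: polar_form_def)
qed

lemma integral_linear_image_compact:
  fixes g :: "real ^ 'm::{finite,wellorder} \<Rightarrow> real ^ 'm::_" and h :: "real ^ 'm::_ \<Rightarrow> real"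
  assumes "linear g" "compact S" "continuous_on UNIV h"
  shows "integral (g ` S) h = \<bar>det (matrix g)\<bar> * integral S (\<lambda>x. h (g x))"
proof -
  let ?h = "\<lambda>x. vec (h x) :: real ^ 1"
  have "compact (g ` S)"
    by (intro compact_continuous_image assms linear_continuous_on) (simp add: linear_linear assms(1))
  then have "?h absolutely_integrable_on (g ` S)"
    unfolding absolutely_integrable_on_1_iff
    using absolutely_integrable_on_compact[OF _ continuous_on_subset[OF assms(3)]] by simp
  then have "integral (g ` S) ?h = \<bar>det (matrix g)\<bar> *\<^sub>R integral S (?h \<circ> g)"
    by (intro integral_change_of_variables_linear[OF assms(1)]) auto
  then show ?thesis by (simp add: integral_on_1_eq vec_eq_iff)
qed

text \<open>Covectors pull back by the adjoint: since \<open>T\<close> is onto,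
  \<open>adjoint T\<close> carries \<open>polar f'\<close> exactly onto \<open>polar f\<close>. Both
  integrals then acquire the same factor, the absolute determinant of the adjoint, which is nonzero
  and cancels.\<close>

lemma polar_form_invariant:
  fixes T :: "real ^ 'm::{finite,wellorder} \<Rightarrow> real ^ 'm::_"
  assumes f': "minkowski_norm f'" and "linear T" "inj T" and T: "\<And>u. f' (T u) = f u"
  shows "polar_form f' (T u) (T v) = polar_form f u v"
proof -
  let ?g = "adjoint T"
  have lin: "linear ?g" by (rule adjoint_linear[OF assms(2)])
  have g: "?g \<xi> \<bullet> u = \<xi> \<bullet> T u" for \<xi> u
    using adjoint_works[OF assms(2), of u \<xi>] by (simp add: inner_commute)
  have surjT: "surj T" using assms(2,3) linear_injective_imp_surjective by blast
  have "inj ?g"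
  proof -
    have "\<xi> = 0" if "?g \<xi> = 0" for \<xi>
    proof -
      obtain u where "\<xi> = T u" using surjT by blast
      then show ?thesis using g[of \<xi> u] that by simp
    qed
    then show ?thesis using linear_injective_0[OF lin] by blast
  qed
  have polar: "polar f = ?g ` polar f'"
  proof -
    have iff: "?g \<xi> \<in> polar f \<longleftrightarrow> \<xi> \<in> polar f'" for \<xi>
      unfolding polar_def mem_Collect_eq g T[symmetric] using surjT by (metis surjD)
    have "surj ?g" using lin \<open>inj ?g\<close> linear_injective_imp_surjective by blast
    then show ?thesis using iff by (metis (no_types, lifting) image_iff subsetI subset_antisym surjD)
  qed
  have "det (matrix ?g) \<noteq> 0" using det_nz_iff_inj[OF lin] \<open>inj ?g\<close> by simp
  moreover have "integral (polar f) h = \<bar>det (matrix ?g)\<bar> * integral (polar f') (\<lambda>x. h (?g x))"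
    if "continuous_on UNIV h" for h :: "real ^ 'm::_ \<Rightarrow> real"
    unfolding polar by (rule integral_linear_image_compact[OF lin compact_polar[OF f'] that])
  ultimately show ?thesis
    by (simp add: polar_form_def g continuous_intros)
qed

text \<open>
  The library's change of variables theorem needs a well-ordered index type. A copy of the given
  index type, ordered by an arbitrary enumeration, makes it applicable to every finite type.
\<close>

typedef 'a ordered_index = "UNIV :: 'a set" ..

instantiation ordered_index :: (finite) "{finite, linorder}"
begin

definition "x < y \<longleftrightarrow> to_nat (Rep_ordered_index x) < to_nat (Rep_ordered_index y)"
definition "x \<le> y \<longleftrightarrow> to_nat (Rep_ordered_index x) \<le> to_nat (Rep_ordered_index y)"

instance
proof
  have "(UNIV :: 'a ordered_index set) = range Abs_ordered_index"
    by (metis Rep_ordered_index_inverse surjI)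
  then show "finite (UNIV :: 'a ordered_index set)" by (metis finite_imageI finite_class.finite_UNIV)
qed (auto simp: less_eq_ordered_index_def less_ordered_index_def Rep_ordered_index_inject)

end

instance ordered_index :: (finite) wellorder
proof -
  have "wf {(x :: 'a ordered_index, y). x < y}"
    by (rule wf_subset[OF wf_measure[of "\<lambda>x. to_nat (Rep_ordered_index x)"]])
      (auto simp: less_ordered_index_def)
  then show "OFCLASS('a ordered_index, wellorder_class)"
    by (rule wf_wellorderI) intro_classes
qed

definition to_ordered :: "real ^ 'n::finite \<Rightarrow> real ^ 'n ordered_index" where
  "to_ordered u = (\<chi> i. u $ Rep_ordered_index i)"

definition from_ordered :: "real ^ 'n ordered_index \<Rightarrow> real ^ 'n::finite" where
  "from_ordered u = (\<chi> i. u $ Abs_ordered_index i)"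

lemma linear_to_ordered: "linear to_ordered" and linear_from_ordered: "linear from_ordered"
  by (auto intro!: linearI simp: to_ordered_def from_ordered_def vec_eq_iff)

lemma from_to_ordered [simp]: "from_ordered (to_ordered u) = u"
  and to_from_ordered [simp]: "to_ordered (from_ordered v) = v"
  by (auto simp: to_ordered_def from_ordered_def vec_eq_iff Abs_ordered_index_inverse Rep_ordered_index_inverse)

lemma inj_to_ordered: "inj to_ordered" and inj_from_ordered: "inj from_ordered"
  by (metis injI from_to_ordered, metis injI to_from_ordered)

definition canonical_form :: "(real ^ 'n::finite \<Rightarrow> real) \<Rightarrow> real ^ 'n \<Rightarrow> real ^ 'n \<Rightarrow> real" where
  "canonical_form f u v = polar_form (\<lambda>\<xi>. f (from_ordered \<xi>)) (to_ordered u) (to_ordered v)"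

lemma canonical_form_commute: "canonical_form f u v = canonical_form f v u"
  by (simp add: canonical_form_def polar_form_commute)

lemma canonical_form_linear_left:
  assumes "minkowski_norm f"
  shows "canonical_form f (a *\<^sub>R u + b *\<^sub>R v) w = a * canonical_form f u w + b * canonical_form f v w"
  using polar_form_linear_left[OF minkowski_norm_compose[OF assms linear_from_ordered inj_from_ordered]]
  by (simp add: canonical_form_def linear_add[OF linear_to_ordered] linear_cmul[OF linear_to_ordered])

lemma bilinear_canonical_form:
  assumes "minkowski_norm f"
  shows "bilinear (canonical_form f)"
proof -
  have 1: "linear (\<lambda>u. canonical_form f u w)" for w
  proof (rule linearI)
    show "canonical_form f (u + v) w = canonical_form f u w + canonical_form f v w" for u v
      using canonical_form_linear_left[OF assms, of 1 u 1 v w] by simp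
    show "canonical_form f (a *\<^sub>R u) w = a *\<^sub>R canonical_form f u w" for a u
      using canonical_form_linear_left[OF assms, of a u 0 0 w] by simp
  qed
  have "(\<lambda>u. canonical_form f u w) = canonical_form f w" for w
    by (rule ext) (rule canonical_form_commute)
  then have "linear (canonical_form f w)" for w using 1[of w] by simp
  then show ?thesis using 1 by (simp add: bilinear_def)
qed

lemma canonical_form_pos:
  assumes "minkowski_norm f" "u \<noteq> 0"
  shows "0 < canonical_form f u u"
  unfolding canonical_form_def
proof (rule polar_form_pos)
  show "minkowski_norm (\<lambda>\<xi>. f (from_ordered \<xi>))"
    by (rule minkowski_norm_compose[OF assms(1) linear_from_ordered inj_from_ordered])
  show "to_ordered u \<noteq> 0"
    using assms(2) linear_injective_0[OF linear_to_ordered] inj_to_ordered by blast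
qed

text \<open>This naturality is used twice: with \<open>T\<close> a Jacobian it makes the form
  independent of the chart, and with \<open>T\<close> a parallel transport it makes the form
  parallel.\<close>

lemma canonical_form_invariant:
  fixes T :: "real ^ 'n::finite \<Rightarrow> real ^ 'n"
  assumes f': "minkowski_norm f'" and T: "linear T" "inj T" "\<And>u. f' (T u) = f u"
  shows "canonical_form f' (T u) (T v) = canonical_form f u v"
proof -
  let ?T = "\<lambda>x. to_ordered (T (from_ordered x))"
  have "polar_form (\<lambda>\<xi>. f' (from_ordered \<xi>)) (?T (to_ordered u)) (?T (to_ordered v))
      = polar_form (\<lambda>\<xi>. f (from_ordered \<xi>)) (to_ordered u) (to_ordered v)"
  proof (rule polar_form_invariant[where T = ?T])
    show "minkowski_norm (\<lambda>\<xi>. f' (from_ordered \<xi>))"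
      by (rule minkowski_norm_compose[OF f' linear_from_ordered inj_from_ordered])
    show "linear ?T"
      using linear_compose[OF linear_compose[OF linear_from_ordered T(1)] linear_to_ordered]
      by (simp add: o_def)
    show "inj ?T"
      using inj_compose[OF inj_compose[OF inj_to_ordered T(2)] inj_from_ordered] by (simp add: o_def)
  qed (simp add: T(3))
  then show ?thesis by (simp add: canonical_form_def)
qed


section \<open>Charts and tangent vectors\<close>

text \<open>A product rule for a linear map and an argument that both move, reduced to basis vectors
  so that derivatives of \<open>L y e\<close> for fixed \<open>e\<close> suffice. It is applied to
  Jacobians along a curve, to the transports \<open>Q\<close> and to the fibre derivative of the
  energy.\<close>

lemma has_vector_derivative_linear_family:
  fixes L :: "'p::real_normed_vector \<Rightarrow> 'a::euclidean_space \<Rightarrow> 'b::real_normed_vector"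
  assumes "open S" "x t \<in> S" and lin: "\<And>y. y \<in> S \<Longrightarrow> linear (L y)"
    and L': "\<And>e. ((\<lambda>y. L y e) has_derivative L' e) (at (x t))"
    and x: "(x has_vector_derivative x') (at t)" and v: "(v has_vector_derivative v') (at t)"
  shows "((\<lambda>s. L (x s) (v s)) has_vector_derivative L (x t) v' + L' (v t) x') (at t)"
proof -
  have expand: "(\<Sum>i\<in>Basis. (u \<bullet> i) *\<^sub>R L y i) = L y u" if "y \<in> S" for y u
  proof -
    have "L y u = L y (\<Sum>i\<in>Basis. (u \<bullet> i) *\<^sub>R i)" by (simp add: euclidean_representation)
    then show ?thesis by (simp only: linear_sum[OF lin[OF that]] linear_cmul[OF lin[OF that]])
  qed
  have "((\<lambda>y. \<Sum>i\<in>Basis. (u \<bullet> i) *\<^sub>R L y i) has_derivative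
      (\<lambda>h. \<Sum>i\<in>Basis. (u \<bullet> i) *\<^sub>R L' i h)) (at (x t))" for u
    by (intro has_derivative_sum has_derivative_scaleR_right L')
  then have "((\<lambda>y. L y u) has_derivative (\<lambda>h. \<Sum>i\<in>Basis. (u \<bullet> i) *\<^sub>R L' i h)) (at (x t))" for u
    by (rule has_derivative_transform_within_open[OF _ assms(1,2)]) (simp add: expand)
  \<comment> \<open>Linearity of \<open>L'\<close> in the vector \<open>u\<close> is not among the
    hypotheses; uniqueness of derivatives forces it.\<close>
  then have L'_expand: "L' u = (\<lambda>h. \<Sum>i\<in>Basis. (u \<bullet> i) *\<^sub>R L' i h)" for u
    using has_derivative_unique[OF L'] by blast
  have Lx: "((\<lambda>s. L (x s) i) has_vector_derivative L' i x') (at t)" for i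
    using vector_derivative_diff_chain_within[OF x has_derivative_at_withinI[OF L']] by (simp add: o_def)
  have vi: "((\<lambda>s. v s \<bullet> i) has_real_derivative v' \<bullet> i) (at t)" for i
    using bounded_linear.has_vector_derivative[OF bounded_linear_inner_left v]
    by (simp add: has_real_derivative_iff_has_vector_derivative)
  have D: "((\<lambda>s. \<Sum>i\<in>Basis. (v s \<bullet> i) *\<^sub>R L (x s) i) has_vector_derivative
      (\<Sum>i\<in>Basis. (v t \<bullet> i) *\<^sub>R L' i x' + (v' \<bullet> i) *\<^sub>R L (x t) i)) (at t)"
    by (intro has_vector_derivative_sum has_vector_derivative_scaleR vi Lx)
  have "isCont x t" using has_vector_derivative_continuous[OF x] .
  then have "\<forall>\<^sub>F s in nhds t. x s \<in> S"
    using assms(1,2) by (simp add: continuous_at_open eventually_nhds)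
  then obtain U where U: "open U" "t \<in> U" "\<And>s. s \<in> U \<Longrightarrow> x s \<in> S"
    unfolding eventually_nhds by blast
  have "((\<lambda>s. L (x s) (v s)) has_vector_derivative
      (\<Sum>i\<in>Basis. (v t \<bullet> i) *\<^sub>R L' i x' + (v' \<bullet> i) *\<^sub>R L (x t) i)) (at t)"
    by (rule has_vector_derivative_transform_within_open[OF D U(1,2)]) (use U(3) expand in auto)
  also have "(\<Sum>i\<in>Basis. (v t \<bullet> i) *\<^sub>R L' i x' + (v' \<bullet> i) *\<^sub>R L (x t) i) = L (x t) v' + L' (v t) x'"
    using expand[OF assms(2), of v'] L'_expand[of "v t"] by (simp add: sum.distrib add.commute)
  finally show ?thesis .
qed

locale atlas =
  fixes A :: "('a::{t2_space, second_countable_topology}, 'n::finite) chart set"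
  assumes atlas: "smooth_atlas A"
begin

abbreviation jac where "jac c d x \<equiv> frechet_derivative (transition c d) (at x)"

definition overlap where "overlap c d = {x \<in> cimage c. param c x \<in> cdom d}"

lemma chart_exists: "\<exists>c\<in>A. p \<in> cdom c"
  using atlas by (auto simp: smooth_atlas_def)

lemma chart:
  assumes "c \<in> A"
  shows open_cdom: "open (cdom c)" and open_cimage: "open (cimage c)"
    and homeo: "homeomorphism (cdom c) (cimage c) (coord c) (param c)"
  using atlas assms by (auto simp: smooth_atlas_def)

lemma param_coord [simp]: "c \<in> A \<Longrightarrow> p \<in> cdom c \<Longrightarrow> param c (coord c p) = p"
  using homeo by (meson homeomorphism_apply1)

lemma coord_param [simp]: "c \<in> A \<Longrightarrow> x \<in> cimage c \<Longrightarrow> coord c (param c x) = x"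
  using homeo by (meson homeomorphism_apply2)

lemma coord_in_cimage: "p \<in> cdom c \<Longrightarrow> coord c p \<in> cimage c"
  by (auto simp: cimage_def)

lemma param_in_cdom: "c \<in> A \<Longrightarrow> x \<in> cimage c \<Longrightarrow> param c x \<in> cdom c"
  by (auto simp: cimage_def)

lemma coord_in_overlap: "c \<in> A \<Longrightarrow> p \<in> cdom c \<Longrightarrow> p \<in> cdom d \<Longrightarrow> coord c p \<in> overlap c d"
  by (simp add: overlap_def coord_in_cimage)

lemma overlap_eq: "c \<in> A \<Longrightarrow> coord c ` (cdom c \<inter> cdom d) = overlap c d"
  by (force simp: overlap_def cimage_def)

lemma overlapD: "x \<in> overlap c d \<Longrightarrow> x \<in> cimage c" "x \<in> overlap c d \<Longrightarrow> param c x \<in> cdom d"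
  by (auto simp: overlap_def)

lemma open_overlap:
  assumes "c \<in> A" "d \<in> A"
  shows "open (overlap c d)"
proof -
  have "continuous_on (cimage c) (param c)" using homeo[OF assms(1)] by (simp add: homeomorphism_def)
  then have "open (param c -` cdom d \<inter> cimage c)"
    using continuous_on_open_vimage[OF open_cimage[OF assms(1)]] open_cdom[OF assms(2)] by blast
  moreover have "param c -` cdom d \<inter> cimage c = overlap c d" by (auto simp: overlap_def)
  ultimately show ?thesis by simp
qed

lemma transition_apply: "transition c d x = coord d (param c x)"
  by (simp add: transition_def)

lemma transition_in_overlap:
  "c \<in> A \<Longrightarrow> d \<in> A \<Longrightarrow> x \<in> overlap c d \<Longrightarrow> param c x \<in> cdom e \<Longrightarrow> transition c d x \<in> overlap d e"
  by (auto simp: transition_apply overlap_def coord_in_cimage)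

lemma smooth_transition: "c \<in> A \<Longrightarrow> d \<in> A \<Longrightarrow> smooth_on (overlap c d) (transition c d)"
  using atlas unfolding smooth_atlas_def by (metis overlap_eq)

lemma has_derivative_transition:
  "c \<in> A \<Longrightarrow> d \<in> A \<Longrightarrow> x \<in> overlap c d \<Longrightarrow> (transition c d has_derivative jac c d x) (at x)"
  by (rule smooth_on_has_derivative[OF smooth_transition])

lemma linear_jac: "c \<in> A \<Longrightarrow> d \<in> A \<Longrightarrow> x \<in> overlap c d \<Longrightarrow> linear (jac c d x)"
  using has_derivative_linear[OF has_derivative_transition] .

lemma jac_self:
  assumes "c \<in> A" "x \<in> cimage c"
  shows "jac c c x u = u"
proof -
  have "(transition c c has_derivative (\<lambda>u. u)) (at x)"
    by (rule has_derivative_transform_within_open[OF has_derivative_ident open_cimage[OF assms(1)] assms(2)])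
      (simp add: transition_apply assms(1))
  from frechet_derivative_at[OF this] show ?thesis by metis
qed

lemma jac_chain:
  assumes "c \<in> A" "d \<in> A" "e \<in> A" "x \<in> overlap c d" "param c x \<in> cdom e"
  shows "jac c e x u = jac d e (transition c d x) (jac c d x u)"
proof -
  let ?U = "overlap c d \<inter> overlap c e"
  have x: "x \<in> ?U" "open ?U"
    using assms(4,5) open_overlap[OF assms(1,2)] open_overlap[OF assms(1,3)]
    by (auto simp: overlap_def intro: open_Int)
  have "((\<lambda>y. transition d e (transition c d y)) has_derivative
      (\<lambda>u. jac d e (transition c d x) (jac c d x u))) (at x)"
    by (rule has_derivative_compose[OF has_derivative_transition has_derivative_transition])
      (use assms transition_in_overlap[OF assms(1,2,4,5)] in blast)+
  then have "(transition c e has_derivative (\<lambda>u. jac d e (transition c d x) (jac c d x u))) (at x)"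
    by (rule has_derivative_transform_within_open[OF _ x(2,1)])
      (auto simp: transition_apply assms(2) dest: overlapD)
  from frechet_derivative_at[OF this] show ?thesis by metis
qed

lemma inj_jac:
  assumes "c \<in> A" "d \<in> A" "x \<in> overlap c d"
  shows "inj (jac c d x)"
proof (rule inj_on_inverseI)
  show "jac d c (transition c d x) (jac c d x u) = u" for u
    using jac_chain[OF assms(1,2,1,3), of u] jac_self[OF assms(1)] assms
    by (metis overlapD(1) param_in_cdom)
qed

section \<open>Tangent vectors, curves and parallel fields in a chart\<close>

lemma tvec_of_apply:
  "tvec_of A c x u d = (if d \<in> A \<and> param c x \<in> cdom d then jac c d x u else 0)"
  by (simp add: tvec_of_def)

lemma tvec_of_self [simp]: "c \<in> A \<Longrightarrow> x \<in> cimage c \<Longrightarrow> tvec_of A c x u c = u"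
  by (simp add: tvec_of_apply jac_self param_in_cdom)

lemma tvec_of_in_tangent_space:
  assumes "c \<in> A" "x \<in> cimage c"
  shows "tvec_of A c x u \<in> tangent_space A (param c x)"
proof -
  have "tvec_of A c x u e = jac d e (coord d (param c x)) (tvec_of A c x u d)"
    if "d \<in> A" "e \<in> A" "param c x \<in> cdom d" "param c x \<in> cdom e" for d e
  proof -
    have "x \<in> overlap c d" using assms(2) that by (simp add: overlap_def)
    from jac_chain[OF assms(1) that(1,2) this that(4)]
    have "jac c e x u = jac d e (coord d (param c x)) (jac c d x u)"
      unfolding transition_apply .
    then show ?thesis using that unfolding tvec_of_apply by (simp only: if_True simp_thms)
  qed
  moreover have "tvec_of A c x u d = 0" if "\<not> (d \<in> A \<and> param c x \<in> cdom d)" for d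
    using that unfolding tvec_of_apply by (simp only: if_False)
  ultimately show ?thesis unfolding tangent_space_def by blast
qed

lemma tangent_space_change_chart:
  "v \<in> tangent_space A p \<Longrightarrow> c \<in> A \<Longrightarrow> d \<in> A \<Longrightarrow> p \<in> cdom c \<Longrightarrow> p \<in> cdom d \<Longrightarrow>
     v d = jac c d (coord c p) (v c)"
  unfolding tangent_space_def by blast

lemma tangent_space_outside:
  "v \<in> tangent_space A p \<Longrightarrow> \<not> (c \<in> A \<and> p \<in> cdom c) \<Longrightarrow> v c = 0"
  unfolding tangent_space_def by blast

lemma tangent_space_eq_tvec_of:
  assumes "v \<in> tangent_space A p" "c \<in> A" "p \<in> cdom c"
  shows "v = tvec_of A c (coord c p) (v c)"
proof
  fix d
  show "v d = tvec_of A c (coord c p) (v c) d"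
    using tangent_space_change_chart[OF assms(1,2) _ assms(3), of d] tangent_space_outside[OF assms(1), of d]
    unfolding tvec_of_apply param_coord[OF assms(2,3)] by metis
qed

lemma tvec_of_linear:
  assumes "c \<in> A" "x \<in> cimage c"
  shows "tvec_of A c x (a *\<^sub>R u + b *\<^sub>R v) = (\<lambda>d. a *\<^sub>R tvec_of A c x u d + b *\<^sub>R tvec_of A c x v d)"
proof
  fix d
  have "linear (jac c d x)" if "d \<in> A" "param c x \<in> cdom d"
    using linear_jac[OF assms(1) that(1)] assms(2) that(2) by (simp add: overlap_def)
  then show "tvec_of A c x (a *\<^sub>R u + b *\<^sub>R v) d = a *\<^sub>R tvec_of A c x u d + b *\<^sub>R tvec_of A c x v d"
    by (simp add: tvec_of_apply linear_add linear_cmul)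
qed

lemma tvec_of_change_chart:
  assumes "c \<in> A" "d \<in> A" "x \<in> overlap c d"
  shows "tvec_of A c x u = tvec_of A d (transition c d x) (jac c d x u)"
proof -
  have "tvec_of A c x u \<in> tangent_space A (param c x)"
    using assms by (intro tvec_of_in_tangent_space overlapD)
  from tangent_space_eq_tvec_of[OF this assms(2) overlapD(2)[OF assms(3)]]
  show ?thesis using assms by (simp add: tvec_of_apply transition_apply overlap_def)
qed

lemma smooth_curve_line:
  assumes c: "c \<in> A" and line: "\<And>t. t \<in> {a<..<b} \<Longrightarrow> x0 + t *\<^sub>R w \<in> cimage c"
  shows "smooth_curve A {a<..<b} (\<lambda>t. param c (x0 + t *\<^sub>R w))"
  unfolding smooth_curve_def
proof (intro conjI ballI)
  show "continuous_on {a<..<b} (\<lambda>t. param c (x0 + t *\<^sub>R w))"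
  proof (rule continuous_on_compose2[of "cimage c" "param c"])
    show "continuous_on (cimage c) (param c)" using homeo[OF c] by (simp add: homeomorphism_def)
  qed (use line in \<open>auto intro!: continuous_intros\<close>)
  show "is_interval {a<..<b}" by (simp add: is_interval_oo)
  fix d assume d: "d \<in> A"
  let ?J = "{t. x0 + t *\<^sub>R w \<in> overlap c d}"
  have lin: "bounded_linear (\<lambda>t. t *\<^sub>R w)" by (rule bounded_linear_scaleR_left)
  have "Ck_on k {t \<in> {a<..<b}. param c (x0 + t *\<^sub>R w) \<in> cdom d} (\<lambda>t. transition c d (x0 + t *\<^sub>R w))" for k
    by (rule Ck_on_subset[OF Ck_on_compose_affine[OF open_overlap[OF c d] lin smooth_on_Ck[OF smooth_transition[OF c d]]]])
      (use line in \<open>auto simp: overlap_def\<close>)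
  then show "smooth_on {t \<in> {a<..<b}. param c (x0 + t *\<^sub>R w) \<in> cdom d} (\<lambda>t. coord d (param c (x0 + t *\<^sub>R w)))"
    by (simp add: smooth_on_def transition_apply)
qed auto

text \<open>Differentiating the Jacobian along the curve produces a second derivative of the
  transition map, and the transformation law of Christoffel symbols cancels exactly this term.
  Solving the transport equation in one chart is therefore enough.\<close>

lemma parallel_along_local:
  assumes \<Gamma>: "affine_connection A \<Gamma>" and c: "c \<in> A" and "open J"
    and x: "\<And>t. t \<in> J \<Longrightarrow> (x has_vector_derivative x' t) (at t)" "\<And>t. t \<in> J \<Longrightarrow> x t \<in> cimage c"
    and v: "\<And>t. t \<in> J \<Longrightarrow> (v has_vector_derivative - \<Gamma> c (x t) (x' t) (v t)) (at t)"
  shows "parallel_along A \<Gamma> J (\<lambda>t. param c (x t)) (\<lambda>t. tvec_of A c (x t) (v t))"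
  unfolding parallel_along_def
proof (intro conjI ballI impI)
  fix t assume t: "t \<in> J"
  show "tvec_of A c (x t) (v t) \<in> tangent_space A (param c (x t))"
    using tvec_of_in_tangent_space[OF c x(2)[OF t]] .
  fix d assume d: "d \<in> A" and td: "param c (x t) \<in> cdom d"
  have xt: "x t \<in> overlap c d" using td x(2)[OF t] by (simp add: overlap_def)
  \<comment> \<open>\<open>tvec_of\<close> has the default value 0 at \<open>d\<close> off the
    overlap, so the Jacobian formula holds only on \<open>U\<close>; a neighbourhood of
    \<open>t\<close> suffices for the derivative.\<close>
  define U where "U = {s \<in> J. x s \<in> overlap c d}"
  have "continuous_on J x"
    using x(1) has_vector_derivative_continuous by (intro continuous_at_imp_continuous_on) blast
  then have "open (x -` overlap c d \<inter> J)"
    using continuous_on_open_vimage[OF \<open>open J\<close>] open_overlap[OF c d] by blast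
  moreover have "U = x -` overlap c d \<inter> J" by (auto simp: U_def)
  ultimately have U: "open U" "t \<in> U" using t xt by (auto simp: U_def)
  define H where "H e = frechet_derivative (\<lambda>y. jac c d y e) (at (x t))" for e
  have tr: "jac c d (x t) (\<Gamma> c (x t) w u) =
      H u w + \<Gamma> d (coord d (param c (x t))) (jac c d (x t) w) (jac c d (x t) u)" for w u
  proof -
    have "param c (x t) \<in> cdom c \<inter> cdom d" using param_in_cdom[OF c x(2)[OF t]] td by simp
    then have "let z = coord c (param c (x t)); \<tau> = transition c d; D = frechet_derivative \<tau> (at z) in
        D (\<Gamma> c z w u) =
          frechet_derivative (\<lambda>y. frechet_derivative \<tau> (at y) u) (at z) w
          + \<Gamma> d (coord d (param c (x t))) (D w) (D u)"
      using \<Gamma> c d unfolding affine_connection_def by blast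
    then show ?thesis
      unfolding Let_def H_def coord_param[OF c x(2)[OF t]] .
  qed
  have "((\<lambda>s. jac c d (x s) (v s)) has_vector_derivative
      jac c d (x t) (- \<Gamma> c (x t) (x' t) (v t)) + H (v t) (x' t)) (at t)"
  proof (rule has_vector_derivative_linear_family[OF open_overlap[OF c d] xt _ _ x(1)[OF t] v[OF t]])
    show "((\<lambda>y. jac c d y e) has_derivative H e) (at (x t))" for e
      unfolding H_def
      using smooth_on_has_derivative[OF smooth_on_frechet_derivative[OF smooth_transition[OF c d]] xt] .
  qed (rule linear_jac[OF c d])
  then have "((\<lambda>s. tvec_of A c (x s) (v s) d) has_vector_derivative
      jac c d (x t) (- \<Gamma> c (x t) (x' t) (v t)) + H (v t) (x' t)) (at t)"
    by (rule has_vector_derivative_transform_within_open[OF _ U])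
      (auto simp: tvec_of_apply U_def d dest: overlapD)
  moreover have "jac c d (x t) (- \<Gamma> c (x t) (x' t) (v t)) + H (v t) (x' t)
      = - \<Gamma> d (coord d (param c (x t))) (jac c d (x t) (x' t)) (jac c d (x t) (v t))"
    by (simp add: linear_neg[OF linear_jac[OF c d xt]] tr)
  moreover have "velocity A (\<lambda>t. param c (x t)) t d = jac c d (x t) (x' t)"
  proof -
    have "((\<lambda>s. transition c d (x s)) has_vector_derivative jac c d (x t) (x' t)) (at t)"
      using vector_derivative_diff_chain_within[OF x(1)[OF t] has_derivative_at_withinI[OF has_derivative_transition[OF c d xt]]]
      by (simp add: o_def)
    then show ?thesis
      using td d by (simp add: velocity_def transition_apply vector_derivative_at)
  qed
  ultimately show "((\<lambda>s. tvec_of A c (x s) (v s) d) has_vector_derivative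
      - \<Gamma> d (coord d (param c (x t))) (velocity A (\<lambda>t. param c (x t)) t d) (tvec_of A c (x t) (v t) d)) (at t)"
    using td d by (simp add: tvec_of_apply)
qed

end


section \<open>The invariant Riemannian metric\<close>

lemma has_derivative_shift:
  "(q has_derivative D) (at 0) \<Longrightarrow> ((\<lambda>x. q (x - x0)) has_derivative D) (at x0)"
  using has_derivative_compose[of "\<lambda>x. x - x0" "\<lambda>h. h" x0 UNIV q D]
  by (simp add: has_derivative_diff[OF has_derivative_ident has_derivative_const, simplified])

locale berwald = atlas A for A :: "('a::{t2_space, second_countable_topology}, 'n::finite) chart set" +
  fixes F :: "'a \<Rightarrow> ('a, 'n) tvec \<Rightarrow> real" and \<Gamma> :: "('a, 'n) connection"
  assumes finsler: "finsler_metric A F" and sym: "symmetric_connection A \<Gamma>"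
    and invariant: "\<And>J \<gamma> s t v w. smooth_curve A J \<gamma> \<Longrightarrow> s \<in> J \<Longrightarrow> t \<in> J \<Longrightarrow>
      parallel_transport A \<Gamma> J \<gamma> s t v w \<Longrightarrow> F (\<gamma> t) w = F (\<gamma> s) v"
begin

definition local_norm where "local_norm c x u = F (param c x) (tvec_of A c x u)"

lemma conn: "affine_connection A \<Gamma>"
  using sym by (simp add: symmetric_connection_def)

lemma \<Gamma>_bilinear: "c \<in> A \<Longrightarrow> x \<in> cimage c \<Longrightarrow> bilinear (\<Gamma> c x)"
  using conn unfolding affine_connection_def by blast

lemma \<Gamma>_smooth: "c \<in> A \<Longrightarrow> smooth_on (cimage c) (\<lambda>x. \<Gamma> c x w u)"
  using conn unfolding affine_connection_def by blast

lemma \<Gamma>_sym: "c \<in> A \<Longrightarrow> x \<in> cimage c \<Longrightarrow> \<Gamma> c x w u = \<Gamma> c x u w"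
  using sym unfolding symmetric_connection_def by blast

lemma F_nonneg: "v \<in> tangent_space A p \<Longrightarrow> 0 \<le> F p v"
  and F_scale: "v \<in> tangent_space A p \<Longrightarrow> 0 \<le> r \<Longrightarrow> F p (\<lambda>c. r *\<^sub>R v c) = r * F p v"
  and F_add: "v \<in> tangent_space A p \<Longrightarrow> w \<in> tangent_space A p \<Longrightarrow> F p (\<lambda>c. v c + w c) \<le> F p v + F p w"
  and F_definite: "v \<in> tangent_space A p \<Longrightarrow> F p v = 0 \<Longrightarrow> v = (\<lambda>c. 0)"
  and F_smooth: "c \<in> A \<Longrightarrow> smooth_on (cimage c \<times> (- {0})) (\<lambda>(x, u). F (param c x) (tvec_of A c x u))"
  using finsler unfolding finsler_metric_def by blast+

lemma minkowski_local_norm: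
  assumes "c \<in> A" "x \<in> cimage c"
  shows "minkowski_norm (local_norm c x)"
  unfolding minkowski_norm_def local_norm_def
proof (intro conjI allI impI)
  note T = tvec_of_in_tangent_space[OF assms]
  fix u v
  show "0 \<le> F (param c x) (tvec_of A c x u)" by (rule F_nonneg[OF T])
  show "F (param c x) (tvec_of A c x (r *\<^sub>R u)) = r * F (param c x) (tvec_of A c x u)" if "0 \<le> r" for r
    using F_scale[OF T that, of u] tvec_of_linear[OF assms, of r u 0 u] by simp
  show "F (param c x) (tvec_of A c x (u + v)) \<le> F (param c x) (tvec_of A c x u) + F (param c x) (tvec_of A c x v)"
    using F_add[OF T T, of u v] tvec_of_linear[OF assms, of 1 u 1 v] by simp
  assume "F (param c x) (tvec_of A c x u) = 0"
  then have "tvec_of A c x u = (\<lambda>c. 0)" by (rule F_definite[OF T])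
  then have "tvec_of A c x u c = 0" by (rule fun_cong)
  then show "u = 0" using assms by simp
qed

lemma local_norm_change_chart:
  assumes "c \<in> A" "d \<in> A" "x \<in> overlap c d"
  shows "local_norm d (transition c d x) (jac c d x u) = local_norm c x u"
proof -
  have "param d (transition c d x) = param c x"
    using assms by (simp add: transition_apply overlap_def)
  then show ?thesis using tvec_of_change_chart[OF assms] by (simp add: local_norm_def)
qed

text \<open>Invariance of \<open>F\<close> is applied from time 1 to time 0 of a segment, so it
  compares the norm at \<open>x0 + w\<close> with that at \<open>x0\<close>. Both the derivative of
  the form and the derivatives of the energy are obtained from this comparison.\<close>

lemma transport_to_centre:
  assumes c: "c \<in> A" and x0: "x0 \<in> cimage c"
  obtains r Q where "r > 0"
    "\<And>w. norm w < r \<Longrightarrow> x0 + w \<in> cimage c"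
    "\<And>w. norm w < r \<Longrightarrow> linear (Q w)"
    "\<And>w u. norm w < r \<Longrightarrow> local_norm c x0 (Q w u) = local_norm c (x0 + w) u"
    "\<And>u. Q 0 u = u"
    "\<And>u. ((\<lambda>w. Q w u) has_derivative (\<lambda>w. \<Gamma> c x0 w u)) (at 0)"
proof -
  have "continuous_on (cimage c) (\<lambda>x. \<Gamma> c x w u)" for w u
    using \<Gamma>_smooth[OF c] smooth_on_Ck Ck_on_imp_continuous_on by blast
  note cont = this
  obtain r Q where r: "r > 0"
    and line: "\<And>w t. norm w < r \<Longrightarrow> t \<in> {-1<..<2} \<Longrightarrow> x0 + t *\<^sub>R w \<in> cimage c"
    and lin: "\<And>w. norm w < r \<Longrightarrow> linear (Q w)"
    and V: "\<And>w u. norm w < r \<Longrightarrow> \<exists>V. V 1 = u \<and> V 0 = Q w u \<and>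
       (\<forall>t\<in>{-1<..<2::real}. (V has_vector_derivative - \<Gamma> c (x0 + t *\<^sub>R w) w (V t)) (at t))"
    and Q0: "\<And>u. Q 0 u = u" "\<And>u. ((\<lambda>w. Q w u) has_derivative (\<lambda>w. \<Gamma> c x0 w u)) (at 0)"
    by (rule line_transport[of "cimage c" x0 "\<Gamma> c", OF open_cimage[OF c] x0 _ cont])
      (rule \<Gamma>_bilinear[OF c], assumption, (rule that; assumption))
  have "local_norm c x0 (Q w u) = local_norm c (x0 + w) u" if w: "norm w < r" for w u
  proof -
    let ?J = "{-1<..<2::real}" and ?\<gamma> = "\<lambda>t. param c (x0 + t *\<^sub>R w)"
    obtain V where V1: "V 1 = u" "V 0 = Q w u"
      "\<And>t. t \<in> ?J \<Longrightarrow> (V has_vector_derivative - \<Gamma> c (x0 + t *\<^sub>R w) w (V t)) (at t)"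
      using V[OF w] by blast
    have "parallel_along A \<Gamma> ?J ?\<gamma> (\<lambda>t. tvec_of A c (x0 + t *\<^sub>R w) (V t))"
    proof (rule parallel_along_local[OF conn c _ _ line[OF w] V1(3)])
      show "((\<lambda>t. x0 + t *\<^sub>R w) has_vector_derivative w) (at t)" for t
        by (auto intro!: derivative_eq_intros)
    qed auto
    \<comment> \<open>Transport is a relation witnessed by any parallel field, so the field just
      built is enough and uniqueness of solutions is not involved.\<close>
    then have "parallel_transport A \<Gamma> ?J ?\<gamma> 1 0 (tvec_of A c (x0 + 1 *\<^sub>R w) (V 1)) (tvec_of A c (x0 + 0 *\<^sub>R w) (V 0))"
      unfolding parallel_transport_def by blast
    from invariant[OF smooth_curve_line[OF c line[OF w]] _ _ this] show ?thesis
      by (simp add: local_norm_def V1)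
  qed
  then show ?thesis using that[of r Q] r lin Q0 line[of _ 1] by simp
qed

section \<open>The invariant form in a chart\<close>

definition local_form where "local_form c x = canonical_form (local_norm c x)"

lemma bilinear_local_form: "c \<in> A \<Longrightarrow> x \<in> cimage c \<Longrightarrow> bilinear (local_form c x)"
  unfolding local_form_def by (intro bilinear_canonical_form minkowski_local_norm)

lemma local_form_pos: "c \<in> A \<Longrightarrow> x \<in> cimage c \<Longrightarrow> u \<noteq> 0 \<Longrightarrow> 0 < local_form c x u u"
  unfolding local_form_def by (intro canonical_form_pos minkowski_local_norm)

lemma local_form_commute: "local_form c x u v = local_form c x v u"
  unfolding local_form_def by (rule canonical_form_commute)

lemma local_form_change_chart:
  assumes "c \<in> A" "d \<in> A" "x \<in> overlap c d"
  shows "local_form d (transition c d x) (jac c d x u) (jac c d x v) = local_form c x u v"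
  unfolding local_form_def
proof (rule canonical_form_invariant)
  show "minkowski_norm (local_norm d (transition c d x))"
    using assms by (intro minkowski_local_norm) (auto simp: transition_apply coord_in_cimage overlap_def)
qed (use assms linear_jac inj_jac local_norm_change_chart in auto)

text \<open>Near \<open>x0\<close> the form is the fixed form at \<open>x0\<close> evaluated on
  \<open>Q w u\<close> and \<open>Q w v\<close>. The product rule at \<open>w = 0\<close>, where
  \<open>Q\<close> is the identity with derivative \<open>\<Gamma>\<close>, gives the coordinate
  form of a parallel metric.\<close>

lemma local_form_has_derivative:
  assumes c: "c \<in> A" and x0: "x0 \<in> cimage c"
  shows "((\<lambda>x. local_form c x u v) has_derivative
    (\<lambda>w. local_form c x0 (\<Gamma> c x0 w u) v + local_form c x0 u (\<Gamma> c x0 w v))) (at x0)"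
proof -
  obtain r Q where Q: "r > 0" "\<And>w. norm w < r \<Longrightarrow> x0 + w \<in> cimage c"
    "\<And>w. norm w < r \<Longrightarrow> linear (Q w)"
    "\<And>w u. norm w < r \<Longrightarrow> local_norm c x0 (Q w u) = local_norm c (x0 + w) u"
    "\<And>u. Q 0 u = u"
    "\<And>u. ((\<lambda>w. Q w u) has_derivative (\<lambda>w. \<Gamma> c x0 w u)) (at 0)"
    by (rule transport_to_centre[OF assms]) (rule that; assumption)
  have form: "local_form c x0 (Q w u) (Q w v) = local_form c (x0 + w) u v" if w: "norm w < r" for w
    unfolding local_form_def
  proof (rule canonical_form_invariant[OF minkowski_local_norm[OF c x0] Q(3)[OF w] _ Q(4)[OF w]])
    \<comment> \<open>Injectivity follows from definiteness of the norms that \<open>Q w\<close>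
      preserves, without constructing an inverse transport.\<close>
    have "u = 0" if "Q w u = 0" for u
      using Q(4)[OF w, of u] that minkowski_norm_zero[OF minkowski_local_norm[OF c x0]]
        minkowski_norm_pos[OF minkowski_local_norm[OF c Q(2)[OF w]], of u] by force
    then show "inj (Q w)" using linear_injective_0[OF Q(3)[OF w]] by blast
  qed
  interpret bounded_bilinear "local_form c x0"
    using bilinear_local_form[OF assms] bilinear_conv_bounded_bilinear by blast
  have "((\<lambda>w. local_form c x0 (Q w u) (Q w v)) has_derivative
      (\<lambda>w. local_form c x0 (Q 0 u) (\<Gamma> c x0 w v) + local_form c x0 (\<Gamma> c x0 w u) (Q 0 v))) (at 0)"
    by (rule FDERIV[OF Q(6) Q(6)])
  from has_derivative_shift[OF this, of x0]
  have "((\<lambda>x. local_form c x0 (Q (x - x0) u) (Q (x - x0) v)) has_derivative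
      (\<lambda>w. local_form c x0 (\<Gamma> c x0 w u) v + local_form c x0 u (\<Gamma> c x0 w v))) (at x0)"
    by (simp add: Q(5) add.commute)
  then show ?thesis
  proof (rule has_derivative_transform_within_open[OF _ open_ball[of x0 r]])
    show "local_form c x0 (Q (x - x0) u) (Q (x - x0) v) = local_form c x u v" if "x \<in> ball x0 r" for x
      using form[of "x - x0"] that by (simp add: dist_norm norm_minus_commute)
  qed (use Q(1) in auto)
qed

text \<open>
  The differential equation above expresses each derivative of the form through the form itself,
  so smoothness follows by bootstrapping from continuity.
\<close>

lemma smooth_local_form:
  assumes c: "c \<in> A"
  shows "smooth_on (cimage c) (\<lambda>x. local_form c x u v)"
proof -
  have "Ck_on k (cimage c) (\<lambda>x. local_form c x u v)" for k
  proof (induction k arbitrary: u v)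
    case 0
    show ?case
      using has_derivative_continuous[OF local_form_has_derivative[OF c]]
      by (auto intro!: continuous_at_imp_continuous_on)
  next
    case (Suc k)
    show ?case
    proof (rule Ck_on_Suc_I[OF open_cimage[OF c] local_form_has_derivative[OF c]])
      fix w
      \<comment> \<open>The induction hypothesis covers only constant arguments of the form.
        Expanding the moving arguments in the basis, after a use of symmetry in the second summand,
        leaves products of functions known to be \<open>Ck_on k\<close>.\<close>
      let ?D = "\<lambda>x. (\<Sum>i\<in>Basis. (\<Gamma> c x w u \<bullet> i) * local_form c x i v) +
        (\<Sum>i\<in>Basis. (\<Gamma> c x w v \<bullet> i) * local_form c x i u)"
      have "Ck_on k (cimage c) (\<lambda>x. \<Gamma> c x w u \<bullet> i)" for u i
        using Ck_on_bounded_linear[OF open_cimage[OF c] bounded_linear_inner_left smooth_on_Ck[OF \<Gamma>_smooth[OF c]]] .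
      then have "Ck_on k (cimage c) ?D"
        by (intro Ck_on_add Ck_on_sum Ck_on_mult open_cimage c Suc.IH)
      then show "Ck_on k (cimage c) (\<lambda>x. local_form c x (\<Gamma> c x w u) v + local_form c x u (\<Gamma> c x w v))"
      proof (rule Ck_on_cong[OF open_cimage[OF c], rotated])
        fix x assume x: "x \<in> cimage c"
        have lin: "linear (\<lambda>y. local_form c x y z)" for z
          using bilinear_local_form[OF c x] by (simp add: bilinear_def)
        have "(\<Sum>i\<in>Basis. (y \<bullet> i) * local_form c x i z) = local_form c x y z" for y z
        proof -
          have "local_form c x y z = local_form c x (\<Sum>i\<in>Basis. (y \<bullet> i) *\<^sub>R i) z"
            by (simp add: euclidean_representation)
          also have "\<dots> = (\<Sum>i\<in>Basis. (y \<bullet> i) * local_form c x i z)"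
            by (simp only: linear_sum[OF lin] linear_cmul[OF lin] real_scaleR_def)
          finally show ?thesis by simp
        qed
        then show "?D x = local_form c x (\<Gamma> c x w u) v + local_form c x u (\<Gamma> c x w v)"
          using local_form_commute[of c x u] by simp
      qed
    qed
  qed
  then show ?thesis by (simp add: smooth_on_def)
qed

text \<open>On tangent vectors at \<open>p\<close> the choice of chart does not affect the value, by
  \<open>local_form_change_chart\<close>.\<close>

definition g :: "'a \<Rightarrow> ('a, 'n) tvec \<Rightarrow> ('a, 'n) tvec \<Rightarrow> real" where
  "g p v w = (let c = SOME c. c \<in> A \<and> p \<in> cdom c in local_form c (coord c p) (v c) (w c))"

lemma g_in_chart:
  assumes c: "c \<in> A" "p \<in> cdom c" and v: "v \<in> tangent_space A p" and w: "w \<in> tangent_space A p"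
  shows "g p v w = local_form c (coord c p) (v c) (w c)"
proof -
  define d where "d = (SOME c. c \<in> A \<and> p \<in> cdom c)"
  have d: "d \<in> A" "p \<in> cdom d"
    unfolding d_def using someI[of "\<lambda>c. c \<in> A \<and> p \<in> cdom c" c] c by auto
  have "g p v w = local_form d (coord d p) (v d) (w d)" by (simp add: g_def d_def Let_def)
  also have "\<dots> = local_form d (transition c d (coord c p)) (jac c d (coord c p) (v c)) (jac c d (coord c p) (w c))"
    using transition_apply[of c d "coord c p"] param_coord[OF c] tangent_space_change_chart[OF v c(1) d(1) c(2) d(2)]
      tangent_space_change_chart[OF w c(1) d(1) c(2) d(2)] by simp
  also have "\<dots> = local_form c (coord c p) (v c) (w c)"
    by (rule local_form_change_chart[OF c(1) d(1) coord_in_overlap[OF c d(2)]])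
  finally show ?thesis .
qed

lemma g_tvec_of:
  assumes "c \<in> A" "x \<in> cimage c"
  shows "g (param c x) (tvec_of A c x u) (tvec_of A c x v) = local_form c x u v"
  using g_in_chart[OF assms(1) param_in_cdom[OF assms] tvec_of_in_tangent_space[OF assms] tvec_of_in_tangent_space[OF assms]]
  by (simp add: assms)

lemma tangent_space_lincomb:
  assumes "v \<in> tangent_space A p" "w \<in> tangent_space A p"
  shows "(\<lambda>c. a *\<^sub>R v c + b *\<^sub>R w c) \<in> tangent_space A p"
proof -
  obtain c where c: "c \<in> A" "p \<in> cdom c" using chart_exists by blast
  have "v = tvec_of A c (coord c p) (v c)" "w = tvec_of A c (coord c p) (w c)"
    using assms c by (auto intro!: tangent_space_eq_tvec_of)
  note vw = this[symmetric]
  have "tvec_of A c (coord c p) (a *\<^sub>R v c + b *\<^sub>R w c) = (\<lambda>c. a *\<^sub>R v c + b *\<^sub>R w c)"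
    by (simp only: tvec_of_linear[OF c(1) coord_in_cimage[OF c(2)]] vw)
  then show ?thesis
    using tvec_of_in_tangent_space[OF c(1) coord_in_cimage[OF c(2)], of "a *\<^sub>R v c + b *\<^sub>R w c"]
    by (simp only: param_coord[OF c])
qed

lemma riemannian_g: "riemannian_metric A g"
  unfolding riemannian_metric_def
proof (intro conjI allI ballI impI)
  fix p v w assume v: "v \<in> tangent_space A p" and w: "w \<in> tangent_space A p"
  show "g p v w = g p w v" unfolding g_def Let_def by (rule local_form_commute)
next
  fix p v v' w a b
  assume T: "v \<in> tangent_space A p" "v' \<in> tangent_space A p" "w \<in> tangent_space A p"
  obtain c where c: "c \<in> A" "p \<in> cdom c" using chart_exists by blast
  show "g p (\<lambda>c. a *\<^sub>R v c + b *\<^sub>R v' c) w = a * g p v w + b * g p v' w"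
    using bilinear_local_form[OF c(1) coord_in_cimage[OF c(2)]]
    by (simp add: g_in_chart[OF c] T tangent_space_lincomb bilinear_ladd bilinear_lmul)
next
  fix p v assume v: "v \<in> tangent_space A p" "v \<noteq> (\<lambda>c. 0)"
  obtain c where c: "c \<in> A" "p \<in> cdom c" using chart_exists by blast
  note ci = coord_in_cimage[OF c(2)]
  have "v c \<noteq> 0"
    using tangent_space_eq_tvec_of[OF v(1) c] tvec_of_linear[OF c(1) ci, of 0 0 0 0] v(2) by auto
  then show "0 < g p v v"
    using local_form_pos[OF c(1) ci] by (simp add: g_in_chart[OF c v(1) v(1)])
next
  fix c u w assume c: "c \<in> A"
  have "Ck_on k (cimage c) (\<lambda>x. g (param c x) (tvec_of A c x u) (tvec_of A c x w))" for k
    using smooth_on_Ck[OF smooth_local_form[OF c]]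
    by (rule Ck_on_cong[OF open_cimage[OF c], rotated]) (simp add: g_tvec_of[OF c])
  then show "smooth_on (cimage c) (\<lambda>x. g (param c x) (tvec_of A c x u) (tvec_of A c x w))"
    by (simp add: smooth_on_def)
qed

text \<open>The derivative of \<open>g\<close> is already expressed through \<open>\<Gamma>\<close>,
  so compatibility of any \<open>\<Gamma>'\<close> becomes algebraic. It is an identity for
  \<open>\<Gamma>\<close> itself, and for another connection it constrains the difference.\<close>

lemma metric_connection_iff:
  "metric_connection A g \<Gamma>' \<longleftrightarrow> (\<forall>c\<in>A. \<forall>x\<in>cimage c. \<forall>w u v.
     local_form c x (\<Gamma> c x w u) v + local_form c x u (\<Gamma> c x w v) =
     local_form c x (\<Gamma>' c x w u) v + local_form c x u (\<Gamma>' c x w v))"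
proof -
  have "frechet_derivative (\<lambda>y. g (param c y) (tvec_of A c y u) (tvec_of A c y v)) (at x)
      = (\<lambda>w. local_form c x (\<Gamma> c x w u) v + local_form c x u (\<Gamma> c x w v))"
    if c: "c \<in> A" and x: "x \<in> cimage c" for c x u v
  proof -
    have "((\<lambda>y. g (param c y) (tvec_of A c y u) (tvec_of A c y v)) has_derivative
        (\<lambda>w. local_form c x (\<Gamma> c x w u) v + local_form c x u (\<Gamma> c x w v))) (at x)"
      by (rule has_derivative_transform_within_open[OF local_form_has_derivative[OF c x] open_cimage[OF c] x])
        (simp add: g_tvec_of[OF c])
    from frechet_derivative_at[OF this] show ?thesis by simp
  qed
  then show ?thesis by (simp add: metric_connection_def Let_def g_tvec_of)
qed

text \<open>
  With \<open>S\<close> the difference of two symmetric metric connections, \<open>T(w, u, v) = g(S(w, u), v)\<close> is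
  symmetric in the first two and alternating in the last two arguments, hence zero.
\<close>

lemma levi_civita_eq:
  assumes c: "c \<in> A" and x: "x \<in> cimage c"
  shows "levi_civita A g c x w u = \<Gamma> c x w u"
proof -
  define \<Gamma>' where "\<Gamma>' = levi_civita A g"
  \<comment> \<open>\<open>\<Gamma>\<close> witnesses that the choice in \<open>levi_civita\<close>
    is not vacuous, so the chosen connection has the defining properties.\<close>
  have "symmetric_connection A \<Gamma> \<and> metric_connection A g \<Gamma>"
    using sym by (simp add: metric_connection_iff)
  then have \<Gamma>': "symmetric_connection A \<Gamma>'" "metric_connection A g \<Gamma>'"
    unfolding \<Gamma>'_def levi_civita_def using someI_ex[of "\<lambda>\<Gamma>. symmetric_connection A \<Gamma> \<and> metric_connection A g \<Gamma>"]
    by blast+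
  note bil = bilinear_local_form[OF c x]
  define T where "T w u v = local_form c x (\<Gamma> c x w u - \<Gamma>' c x w u) v" for w u v
  have T1: "T w u v = T u w v" for w u v
  proof -
    have "\<Gamma>' c x w u = \<Gamma>' c x u w"
      using \<Gamma>'(1) c x unfolding symmetric_connection_def by blast
    then show ?thesis by (simp add: T_def \<Gamma>_sym[OF c x, of w u])
  qed
  have T2: "T w u v = - T w v u" for w u v
  proof -
    have "local_form c x (\<Gamma> c x w u) v + local_form c x u (\<Gamma> c x w v) =
        local_form c x (\<Gamma>' c x w u) v + local_form c x u (\<Gamma>' c x w v)"
      using \<Gamma>'(2) c x unfolding metric_connection_iff by blast
    then show ?thesis
      by (simp add: T_def bilinear_lsub[OF bil] local_form_commute[of c x u])
  qed
  \<comment> \<open>Alternating the two symmetries gives \<open>T w u v = T u w v = - T u v w = - T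
    v u w = T v w u = T w v u = - T w u v\<close>.\<close>
  have "T w u v = 0" for v
    using T1[of w u v] T1[of w v u] T1[of u v w] T2[of w u v] T2[of u w v] T2[of v w u] by linarith
  then have "local_form c x (\<Gamma> c x w u - \<Gamma>' c x w u) (\<Gamma> c x w u - \<Gamma>' c x w u) = 0"
    by (simp add: T_def)
  then show ?thesis using local_form_pos[OF c x, of "\<Gamma> c x w u - \<Gamma>' c x w u"] by (force simp: \<Gamma>'_def)
qed

end


section \<open>Geodesics\<close>

context berwald
begin

text \<open>The geodesic equation evaluates a connection only in charts of \<open>A\<close> at
  points of their images, exactly where the chosen connection agrees with
  \<open>\<Gamma>\<close>.\<close>

lemma geodesic_levi_civita: "geodesic A (levi_civita A g) J \<gamma> \<Longrightarrow> geodesic A \<Gamma> J \<gamma>"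
  unfolding geodesic_def parallel_along_def by (simp add: levi_civita_eq coord_in_cimage)

lemma curve_chart_open:
  assumes "smooth_curve A J \<gamma>" "c \<in> A"
  shows "open {s \<in> J. \<gamma> s \<in> cdom c}"
proof -
  have "open (\<gamma> -` cdom c \<inter> J)"
    using assms continuous_on_open_vimage[of J \<gamma>] open_cdom by (auto simp: smooth_curve_def)
  moreover have "\<gamma> -` cdom c \<inter> J = {s \<in> J. \<gamma> s \<in> cdom c}" by auto
  ultimately show ?thesis by simp
qed

lemma velocity_in_chart:
  assumes "smooth_curve A J \<gamma>" "c \<in> A" "t \<in> J" "\<gamma> t \<in> cdom c"
  shows "((\<lambda>s. coord c (\<gamma> s)) has_vector_derivative velocity A \<gamma> t c) (at t)"
proof -
  have "smooth_on {s \<in> J. \<gamma> s \<in> cdom c} (\<lambda>s. coord c (\<gamma> s))"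
    using assms by (simp add: smooth_curve_def)
  then have "(\<lambda>s. coord c (\<gamma> s)) differentiable (at t)"
    using smooth_on_has_derivative[of _ _ t] assms by (force simp: differentiable_def)
  then show ?thesis using assms by (simp add: velocity_def vector_derivative_works[symmetric])
qed

lemma geodesic_velocity_in_chart:
  assumes "geodesic A \<Gamma> J \<gamma>" "c \<in> A" "t \<in> J" "\<gamma> t \<in> cdom c"
  shows "((\<lambda>s. velocity A \<gamma> s c) has_vector_derivative
    - \<Gamma> c (coord c (\<gamma> t)) (velocity A \<gamma> t c) (velocity A \<gamma> t c)) (at t)"
  using assms unfolding geodesic_def parallel_along_def by blast

text \<open>Vanishing derivatives make the coordinates constant on small balls of times, and the
  interval is connected.\<close>

lemma constant_of_zero_velocity:
  assumes \<gamma>: "smooth_curve A J \<gamma>" and "\<And>t. t \<in> J \<Longrightarrow> velocity A \<gamma> t = (\<lambda>c. 0)" "s \<in> J" "t \<in> J"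
  shows "\<gamma> s = \<gamma> t"
proof -
  have "connected J" "open J" using \<gamma> is_interval_connected by (auto simp: smooth_curve_def)
  have "\<gamma> constant_on J"
  proof (rule locally_constant_imp_constant[OF \<open>connected J\<close>])
    fix r assume r: "r \<in> J"
    obtain c where c: "c \<in> A" "\<gamma> r \<in> cdom c" using chart_exists by blast
    have "open {s \<in> J. \<gamma> s \<in> cdom c}" by (rule curve_chart_open[OF \<gamma> c(1)])
    then obtain e where e: "e > 0" "ball r e \<subseteq> {s \<in> J. \<gamma> s \<in> cdom c}"
      using r c(2) open_contains_ball by (metis (mono_tags, lifting) mem_Collect_eq)
    have "((\<lambda>s. coord c (\<gamma> s)) has_vector_derivative 0) (at s within ball r e)" if "s \<in> ball r e" for s
    proof -
      have s: "s \<in> J" "\<gamma> s \<in> cdom c" using e(2) that by auto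
      show ?thesis
        using velocity_in_chart[OF \<gamma> c(1) s] assms(2)[OF s(1)]
        by (simp add: has_vector_derivative_at_within)
    qed
    then obtain k where k: "\<And>s. s \<in> ball r e \<Longrightarrow> coord c (\<gamma> s) = k"
      using has_vector_derivative_zero_constant[OF convex_ball] by metis
    have "\<gamma> s = \<gamma> r" if "s \<in> ball r e" for s
    proof -
      have "\<gamma> s \<in> cdom c" using e(2) that by auto
      moreover have "coord c (\<gamma> s) = coord c (\<gamma> r)" using k[OF that] k[of r] e(1) by simp
      ultimately show ?thesis by (metis param_coord c)
    qed
    moreover have "ball r e \<subseteq> J" using e(2) by auto
    then have "openin (top_of_set J) (ball r e)" by (intro open_subset open_ball)
    moreover have "r \<in> ball r e" using e(1) by simp
    ultimately show "\<exists>U. openin (top_of_set J) U \<and> r \<in> U \<and> (\<forall>y\<in>U. \<gamma> y = \<gamma> r)" by blast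
  qed
  then show ?thesis using assms(3,4) by (auto simp: constant_on_def)
qed

text \<open>The velocity is parallel, so its \<open>F\<close>-length is constant. One zero would
  give length 0 everywhere, hence zero velocity by definiteness and a constant curve.\<close>

lemma geodesic_velocity_nonzero:
  assumes \<gamma>: "geodesic A \<Gamma> J \<gamma>" and ne: "s \<in> J" "s' \<in> J" "\<gamma> s \<noteq> \<gamma> s'" and t: "t \<in> J"
  shows "velocity A \<gamma> t \<noteq> (\<lambda>c. 0)"
proof
  assume 0: "velocity A \<gamma> t = (\<lambda>c. 0)"
  have sm: "smooth_curve A J \<gamma>" and par: "parallel_along A \<Gamma> J \<gamma> (velocity A \<gamma>)"
    using \<gamma> by (auto simp: geodesic_def)
  have T: "velocity A \<gamma> r \<in> tangent_space A (\<gamma> r)" if "r \<in> J" for r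
    using par that by (simp add: parallel_along_def)
  have "velocity A \<gamma> r = (\<lambda>c. 0)" if r: "r \<in> J" for r
  proof -
    have "parallel_transport A \<Gamma> J \<gamma> t r (velocity A \<gamma> t) (velocity A \<gamma> r)"
      using par unfolding parallel_transport_def by blast
    from invariant[OF sm t r this]
    have "F (\<gamma> r) (velocity A \<gamma> r) = F (\<gamma> t) (velocity A \<gamma> t)" .
    also have "\<dots> = 0" using F_scale[OF T[OF t], of 0] by (simp add: 0)
    finally show ?thesis by (rule F_definite[OF T[OF r]])
  qed
  then show False using constant_of_zero_velocity[OF sm] ne by blast
qed

section \<open>The Euler--Lagrange equations\<close>

definition energy where "energy c x u = (local_norm c x u)\<^sup>2 / 2"

text \<open>The fibre inclusion is affine, so smoothness of \<open>F\<close> off the zero section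
  restricts to it. Smoothness in one fibre suffices below, because \<open>Q\<close> accounts for the
  change of base point.\<close>

lemma smooth_energy:
  assumes c: "c \<in> A" and x: "x \<in> cimage c"
  shows "smooth_on (- {0}) (energy c x)"
proof -
  let ?S = "cimage c \<times> (- {0 :: real ^ 'n})"
  have o: "open ?S" by (intro open_Times open_cimage c) (simp add: open_Compl)
  have lin: "bounded_linear (\<lambda>u :: real ^ 'n. (0 :: real ^ 'n, u))"
    by (rule bounded_linear_Pair[OF bounded_linear_zero bounded_linear_ident])
  have S: "- {0} \<subseteq> {u :: real ^ 'n. (x, 0) + (0, u) \<in> ?S}" using x by auto
  have "Ck_on k (- {0}) (\<lambda>u. local_norm c x u)" for k
    using Ck_on_subset[OF Ck_on_compose_affine[OF o lin smooth_on_Ck[OF F_smooth[OF c]], where a = "(x, 0)"] S]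
    by (simp add: local_norm_def)
  then have "Ck_on k (- {0}) (\<lambda>u. (local_norm c x u * local_norm c x u) * (1 / 2))" for k
    by (intro Ck_on_mult Ck_on_const) (auto simp: open_Compl)
  then show ?thesis by (simp add: smooth_on_def energy_def[abs_def] power2_eq_square)
qed

text \<open>
  Near \<open>x0 = x(t)\<close> the energy satisfies \<open>L(x, u) = L(x0, Q(x - x0) u)\<close>. Along a geodesic the curve
  \<open>y(s) = Q(x(s) - x0) u(s)\<close> has vanishing derivative at \<open>t\<close>, so the left-hand side of the
  Euler--Lagrange equation only sees the derivative \<open>\<Gamma>(u, e)\<close> of \<open>Q e\<close>, while the right-hand
  side gives \<open>\<Gamma>(e, u)\<close>.
\<close>

lemma geodesic_euler_lagrange:
  assumes \<gamma>: "geodesic A \<Gamma> J \<gamma>" and t: "t \<in> J" and c: "c \<in> A" and tc: "\<gamma> t \<in> cdom c"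
    and nz: "\<And>s. s \<in> J \<Longrightarrow> velocity A \<gamma> s \<noteq> (\<lambda>c. 0)"
  defines "x \<equiv> \<lambda>s. coord c (\<gamma> s)" and "u \<equiv> \<lambda>s. velocity A \<gamma> s c"
  shows "((\<lambda>s. frechet_derivative (energy c (x s)) (at (u s)) e) has_real_derivative
    frechet_derivative (\<lambda>y. energy c y (u t)) (at (x t)) e) (at t)"
proof -
  have sm: "smooth_curve A J \<gamma>" and par: "parallel_along A \<Gamma> J \<gamma> (velocity A \<gamma>)"
    using \<gamma> by (auto simp: geodesic_def)
  let ?U = "{s \<in> J. \<gamma> s \<in> cdom c}"
  define x0 where "x0 = x t"
  have x0: "x0 \<in> cimage c" using tc by (simp add: x0_def x_def coord_in_cimage)
  have dx: "(x has_vector_derivative u s) (at s)" if "s \<in> ?U" for s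
    unfolding x_def u_def using velocity_in_chart[OF sm c] that by auto
  have du: "(u has_vector_derivative - \<Gamma> c x0 (u t) (u t)) (at t)"
    unfolding u_def x0_def x_def by (rule geodesic_velocity_in_chart[OF \<gamma> c t tc])
  have u0: "u s \<noteq> 0" if s: "s \<in> ?U" for s
  proof
    assume "u s = 0"
    have "velocity A \<gamma> s \<in> tangent_space A (\<gamma> s)"
      using par s by (simp add: parallel_along_def)
    from tangent_space_eq_tvec_of[OF this c]
    have "velocity A \<gamma> s = tvec_of A c (x s) 0" using s \<open>u s = 0\<close> by (simp add: u_def x_def)
    also have "\<dots> = (\<lambda>c. 0)"
      using tvec_of_linear[OF c coord_in_cimage, of "\<gamma> s" 0 0 0 0] s by (simp add: x_def)
    finally show False using nz s by simp
  qed
  have tU: "t \<in> ?U" using t tc by simp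
  obtain r Q where "r > 0" and img: "\<And>w. norm w < r \<Longrightarrow> x0 + w \<in> cimage c"
    and lin: "\<And>w. norm w < r \<Longrightarrow> linear (Q w)"
    and norm: "\<And>w u. norm w < r \<Longrightarrow> local_norm c x0 (Q w u) = local_norm c (x0 + w) u"
    and Q0: "\<And>u. Q 0 u = u"
    and dQ: "\<And>u. ((\<lambda>w. Q w u) has_derivative (\<lambda>w. \<Gamma> c x0 w u)) (at 0)"
    by (rule transport_to_centre[OF c x0]) (rule that; assumption)
  define \<phi> where "\<phi> = energy c x0"
  have \<phi>: "smooth_on (- {0}) \<phi>" unfolding \<phi>_def by (rule smooth_energy[OF c x0])
  have energy: "energy c y v = \<phi> (Q (y - x0) v)" if "y \<in> ball x0 r" for y v
    using norm[of "y - x0" v] that by (simp add: energy_def \<phi>_def dist_norm norm_minus_commute)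
  have d\<phi>: "(\<phi> has_derivative frechet_derivative \<phi> (at v)) (at v)" if "v \<noteq> 0" for v
    using smooth_on_has_derivative[OF \<phi>] that by simp

  have "((\<lambda>w. \<phi> (Q w (u t))) has_derivative (\<lambda>w. frechet_derivative \<phi> (at (u t)) (\<Gamma> c x0 w (u t)))) (at 0)"
    using has_derivative_compose[OF dQ[of "u t"], of \<phi> "frechet_derivative \<phi> (at (u t))"] d\<phi>[OF u0[OF tU]]
    by (simp add: Q0)
  from has_derivative_shift[OF this, of x0]
  have "((\<lambda>y. energy c y (u t)) has_derivative (\<lambda>w. frechet_derivative \<phi> (at (u t)) (\<Gamma> c x0 w (u t)))) (at x0)"
    by (rule has_derivative_transform_within_open[OF _ open_ball[of x0 r]])
      (use \<open>r > 0\<close> energy in auto)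
  from frechet_derivative_at[OF this]
  have rhs: "frechet_derivative (\<lambda>y. energy c y (u t)) (at (x t)) e = frechet_derivative \<phi> (at (u t)) (\<Gamma> c x0 e (u t))"
    unfolding x0_def by metis

  have dshift: "((\<lambda>s. x s - x0) has_vector_derivative u t) (at t)"
    using has_vector_derivative_diff[OF dx[OF tU] has_vector_derivative_const] by simp
  have linB: "linear (Q w)" if "w \<in> ball 0 r" for w using lin that by simp
  have x00: "x t - x0 \<in> ball 0 r" "x t - x0 = 0" using \<open>r > 0\<close> by (auto simp: x0_def)
  define y where "y s = Q (x s - x0) (u s)" for s
  define z where "z s = Q (x s - x0) e" for s
  have yt: "y t = u t" by (simp add: y_def x00 Q0)
  \<comment> \<open>The two summands cancel: the first is the acceleration given by the geodesic
    equation, the second the first-order change of \<open>Q\<close>.\<close>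
  have "(y has_vector_derivative Q (x t - x0) (- \<Gamma> c x0 (u t) (u t)) + \<Gamma> c x0 (u t) (u t)) (at t)"
    unfolding y_def[abs_def]
    by (rule has_vector_derivative_linear_family[OF open_ball x00(1) linB _ dshift du])
      (simp_all add: x00 dQ)
  then have dy: "(y has_vector_derivative 0) (at t)" by (simp add: x00 Q0)
  have "(z has_vector_derivative Q (x t - x0) 0 + \<Gamma> c x0 (u t) e) (at t)"
    unfolding z_def[abs_def]
    by (rule has_vector_derivative_linear_family[OF open_ball x00(1) linB _ dshift has_vector_derivative_const])
      (simp_all add: x00 dQ)
  then have dz: "(z has_vector_derivative \<Gamma> c x0 (u t) e) (at t)" by (simp add: x00 Q0)
  define H where "H e = frechet_derivative (\<lambda>v. frechet_derivative \<phi> (at v) e) (at (y t))" for e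
  have dH: "((\<lambda>v. frechet_derivative \<phi> (at v) e) has_derivative H e) (at (y t))" for e
    unfolding H_def
    by (rule smooth_on_has_derivative[OF smooth_on_frechet_derivative[OF \<phi>]]) (use yt u0[OF tU] in simp)
  have "((\<lambda>s. frechet_derivative \<phi> (at (y s)) (z s)) has_vector_derivative
      frechet_derivative \<phi> (at (y t)) (\<Gamma> c x0 (u t) e) + H (z t) 0) (at t)"
  proof (rule has_vector_derivative_linear_family[OF _ _ _ dH dy dz])
    show "open (- {0 :: real ^ 'n})" by (simp add: open_Compl)
    show "y t \<in> - {0}" using yt u0[OF tU] by simp
    show "linear (frechet_derivative \<phi> (at v))" if "v \<in> - {0}" for v
      using has_derivative_linear[OF d\<phi>] that by simp
  qed
  \<comment> \<open>The second fibre derivative of the energy enters only applied to the zero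
    derivative of \<open>y\<close>, so its possible degeneracy does no harm.\<close>
  moreover have "H (z t) 0 = 0" using linear_0[OF has_derivative_linear[OF dH]] .
  ultimately have D: "((\<lambda>s. frechet_derivative \<phi> (at (y s)) (z s)) has_vector_derivative
      frechet_derivative \<phi> (at (u t)) (\<Gamma> c x0 (u t) e)) (at t)" by (simp add: yt)

  let ?W = "x -` ball x0 r \<inter> ?U"
  have "continuous_on ?U x"
    using dx has_vector_derivative_continuous by (intro continuous_at_imp_continuous_on) blast
  then have W: "open ?W" "t \<in> ?W"
    using continuous_on_open_vimage[OF curve_chart_open[OF sm c]] tU \<open>r > 0\<close> by (auto simp: x0_def)
  have eq: "frechet_derivative \<phi> (at (y s)) (z s) = frechet_derivative (energy c (x s)) (at (u s)) e"
    if s: "s \<in> ?W" for s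
  proof -
    let ?Q = "Q (x s - x0)"
    have w: "norm (x s - x0) < r" using s by (simp add: dist_norm norm_minus_commute)
    have E: "energy c (x s) = (\<lambda>v. \<phi> (?Q v))" using energy s by (simp add: fun_eq_iff)
    \<comment> \<open>The chain rule at \<open>y s\<close> requires \<open>y s \<noteq> 0\<close>,
      since \<open>\<phi>\<close> is known to be differentiable only off the origin;
      \<open>Q\<close> preserves the positive norm of \<open>u s\<close>.\<close>
    have "0 < local_norm c (x s) (u s)"
      using s u0 by (intro minkowski_norm_pos[OF minkowski_local_norm[OF c]])
        (auto simp: x_def coord_in_cimage)
    then have "y s \<noteq> 0"
      using norm[OF w, of "u s"] minkowski_norm_zero[OF minkowski_local_norm[OF c x0]] by (auto simp: y_def)
    have "(?Q has_derivative ?Q) (at (u s))"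
      using lin[OF w] by (rule linear_imp_has_derivative)
    from has_derivative_compose[OF this, of \<phi>] d\<phi>[OF \<open>y s \<noteq> 0\<close>]
    have "(energy c (x s) has_derivative (\<lambda>e. frechet_derivative \<phi> (at (y s)) (?Q e))) (at (u s))"
      unfolding E y_def by blast
    from frechet_derivative_at[OF this] show ?thesis unfolding z_def by metis
  qed
  have "((\<lambda>s. frechet_derivative (energy c (x s)) (at (u s)) e) has_vector_derivative
      frechet_derivative \<phi> (at (u t)) (\<Gamma> c x0 (u t) e)) (at t)"
    by (rule has_vector_derivative_transform_within_open[OF D W eq])
  \<comment> \<open>Absence of torsion is what identifies the two sides of the equation.\<close>
  then show ?thesis
    unfolding rhs \<Gamma>_sym[OF c x0, of e] by (simp add: has_real_derivative_iff_has_vector_derivative)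
qed

text \<open>The nonconstancy clause of \<open>riemannian_geodesic\<close> supplies the nonvanishing
  velocity required of an \<open>F\<close>-geodesic, which also keeps the energy differentiable
  along the curve.\<close>

lemma finsler_geodesic_of_riemannian_geodesic:
  assumes "riemannian_geodesic A g J \<gamma>"
  shows "finsler_geodesic A F J \<gamma>"
proof -
  obtain s s' where s: "s \<in> J" "s' \<in> J" "\<gamma> s \<noteq> \<gamma> s'" and "geodesic A (levi_civita A g) J \<gamma>"
    using assms unfolding riemannian_geodesic_def by blast
  then have \<gamma>: "geodesic A \<Gamma> J \<gamma>" by (intro geodesic_levi_civita)
  have nz: "velocity A \<gamma> t \<noteq> (\<lambda>c. 0)" if "t \<in> J" for t
    by (rule geodesic_velocity_nonzero[OF \<gamma> s that])
  have "euler_lagrange A (\<lambda>p v. (F p v)\<^sup>2 / 2) J \<gamma>"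
    unfolding euler_lagrange_def Let_def
    using geodesic_euler_lagrange[OF \<gamma> _ _ _ nz]
    unfolding energy_def[abs_def] local_norm_def by blast
  then show ?thesis
    using \<gamma> nz by (simp add: finsler_geodesic_def geodesic_def)
qed

end

theorem theorem1:
  fixes A :: "('a::{t2_space, second_countable_topology}, 'n::finite) chart set"
    and F :: "'a \<Rightarrow> ('a, 'n) tvec \<Rightarrow> real"
  assumes "smooth_atlas A"
    and "CARD('n) \<ge> 2"
    and "berwald_metric A F"
  shows "\<exists>g. riemannian_metric A g \<and>
           affine_equivalent (riemannian_geodesic A g) (finsler_geodesic A F)"
proof -
  obtain \<Gamma> where "symmetric_connection A \<Gamma>" and
    "\<And>J \<gamma> s t v w. smooth_curve A J \<gamma> \<Longrightarrow> s \<in> J \<Longrightarrow> t \<in> J \<Longrightarrow>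
       parallel_transport A \<Gamma> J \<gamma> s t v w \<Longrightarrow> F (\<gamma> t) w = F (\<gamma> s) v"
    and "finsler_metric A F"
    using assms(3) unfolding berwald_metric_def by blast
  then interpret berwald A F \<Gamma>
    using assms(1) by unfold_locales
  show ?thesis
    unfolding affine_equivalent_def
    using riemannian_g finsler_geodesic_of_riemannian_geodesic by blast
qed

end
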